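(* Let $n,d$ be integers with $n,d\geq 2$. Let $q=p^n$, where $p$ is a prime such that $q \equiv -1 \pmod d$ and $p\geq 2(4n-1)^2 d$. Let $H$ be the subgroup of $\mathbb{F}_{q^2}^*$ with index $d$. Let $S$ be a union of at most $d/2$ cosets of $H$ in $\mathbb{F}_{q^2}^*$ such that $\mathbb{F}_q^* \subseteq S$. If $A \subseteq \mathbb{F}_{q^2}$ is such that $0,1\in A$, $|A|=q$, and $A-A \subseteq S \cup \{0\}$, then $A=\mathbb{F}_q$.
   Context: $\mathbb{F}_q$ denotes the finite field with $q$ elements, regarded as the unique subfield of order $q$ of the field $\mathbb{F}_{q^2}$ with $q^2$ elements; $\mathbb{F}_q^*=\mathbb{F}_q\setminus\{0\}$ and $\mathbb{F}_{q^2}^*=\mathbb{F}_{q^2}\setminus\{0\}$ are the multiplicative groups. $A-A=\{a-b: a,b\in A\}$. *)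

theory Defs
  imports "HOL-Library.Cardinality" "HOL-Algebra.Algebraic_Closure_Type" "HOL-Number_Theory.Number_Theory"
begin

text \<open>
  The field of order \<open>q\<^sup>2\<close> is a type of class \<open>{field, finite}\<close> with \<open>q\<^sup>2\<close> elements. The library's
  \<^const>\<open>ring_of_type_algebra\<close> is the HOL-Algebra record of such a type; through it the notions of
  subfield, subgroup and coset are taken from HOL-Algebra.
\<close>

abbreviation field_units :: "'a::field monoid"
  where "field_units \<equiv> Multiplicative_Group.mult_of ring_of_type_algebra"

end

theory Submission
  imports Defs
begin

text \<open>
  View the field with \<open>q\<^sup>2\<close> elements as an affine plane over its subfield of order \<open>q\<close>. As \<open>d\<close>
  divides \<open>q + 1\<close>, the set \<open>S\<close> is a union of at most \<open>(q + 1) / 2\<close> punctured lines through \<open>0\<close>, so \<open>A\<close> is a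
  set of \<open>q\<close> points that determines at most \<open>(q + 1) / 2\<close> directions.

  Such a set is closed under addition. Lacunarity of the Redei polynomial forces every line in a determined
  direction to meet \<open>A\<close> in a multiple of \<open>p\<close> points. Let \<open>s\<close> be the largest power of \<open>p\<close> that divides all these
  numbers. In a direction where \<open>s\<close> is attained, the \<open>s\<close>-th root of the Redei polynomial either is an affine
  linearized polynomial, so that \<open>A\<close> projects onto an additive subgroup, or has many points on long lines. A second
  moment count shows that the latter is rare. If \<open>a, b \<in> A\<close>, then every line through \<open>a + b\<close> in one of the many
  directions of the first kind contains at least \<open>s\<close> points of \<open>A\<close>, and this is too much unless \<open>a + b \<in> A\<close>.

  If the additive group \<open>A\<close> is not the subfield of order \<open>q\<close>, it contains an element \<open>\<theta>\<close> of degree \<open>2n\<close> over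
  the prime field. All \<open>\<theta> + x\<close> with \<open>x\<close> in the prime field lie in \<open>S\<close>, that is, in at most half of the cosets
  of \<open>H\<close>. Stepanov's method excludes this when \<open>p\<close> is large.
\<close>

section \<open>Polynomials over finite fields\<close>

lemma prime_CHAR_finite_field: "prime CHAR('a::{field,finite})"
proof -
  have "CHAR('a) > 0"
    by (metis CHAR_dvd_CARD dvd_0_left_iff gr0I zero_less_card_finite less_irrefl)
  thus ?thesis by (metis CHAR_not_1' One_nat_def prime_CHAR_semidom)
qed

lemma frobenius_add:
  fixes x y :: "'b::comm_ring_1"
  assumes "prime CHAR('b)" "s = CHAR('b) ^ k"
  shows "(x + y) ^ s = x ^ s + y ^ s" "(x - y) ^ s = x ^ s - y ^ s"
proof -
  show add: "(x + y) ^ s = x ^ s + y ^ s" for x y :: 'b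
    using freshmans_dream' assms by blast
  show "(x - y) ^ s = x ^ s - y ^ s"
    using add[of "x - y" y] by simp
qed

lemma pderiv_power_char:
  fixes f :: "'b::idom poly"
  assumes "CHAR('b) dvd s"
  shows "pderiv (f ^ s) = 0"
proof -
  have "of_nat s = (0::'b)" using assms by (simp add: of_nat_eq_0_iff_char_dvd)
  thus ?thesis by (simp add: pderiv_power)
qed

lemma frobenius_eq_iff:
  fixes x y :: "'a::{field,finite}"
  shows "x ^ (CHAR('a) ^ k) = y ^ (CHAR('a) ^ k) \<longleftrightarrow> x = y"
proof
  assume "x ^ (CHAR('a) ^ k) = y ^ (CHAR('a) ^ k)"
  hence "(x - y) ^ (CHAR('a) ^ k) = 0"
    by (simp add: frobenius_add(2)[OF prime_CHAR_finite_field refl])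
  thus "x = y" by simp
qed simp

lemma frobenius_surj:
  fixes \<tau> :: "'a::{field,finite}"
  shows "\<exists>\<sigma>. \<sigma> ^ (CHAR('a) ^ k) = \<tau>"
proof -
  let ?s = "CHAR('a) ^ k"
  have "inj (\<lambda>x::'a. x ^ ?s)" by (rule injI) (simp add: frobenius_eq_iff)
  hence "surj (\<lambda>x::'a. x ^ ?s)" by (simp add: finite_UNIV_inj_surj)
  thus ?thesis by (metis surjD)
qed

lemma frobenius_poly:
  fixes f g :: "'a::{field,finite} poly"
  shows "(f + g) ^ (CHAR('a) ^ k) = f ^ (CHAR('a) ^ k) + g ^ (CHAR('a) ^ k)"
        "(f - g) ^ (CHAR('a) ^ k) = f ^ (CHAR('a) ^ k) - g ^ (CHAR('a) ^ k)"
proof -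
  have *: "prime CHAR('a poly)" using prime_CHAR_finite_field[where 'a='a] by simp
  show "(f + g) ^ (CHAR('a) ^ k) = f ^ (CHAR('a) ^ k) + g ^ (CHAR('a) ^ k)"
       "(f - g) ^ (CHAR('a) ^ k) = f ^ (CHAR('a) ^ k) - g ^ (CHAR('a) ^ k)"
    using frobenius_add[OF *] by simp_all
qed

text \<open>The leading exponent is divisible by the characteristic and the leading coefficient has
  a root under Frobenius, so the leading term is a \<open>CHAR('a)\<close>-th power. Subtracting it
  lowers the degree, and Frobenius is additive.\<close>

lemma pderiv_eq_0_imp_power:
  fixes f :: "'a::{field,finite} poly"
  assumes "pderiv f = 0"
  shows "\<exists>g. f = g ^ CHAR('a)"
  using assms
proof (induction "degree f" arbitrary: f rule: less_induct)
  case less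
  let ?p = "CHAR('a)"
  have p: "prime ?p" by (rule prime_CHAR_finite_field)
  define m where "m = degree f"
  obtain b where b: "b ^ ?p = lead_coeff f" using frobenius_surj[of 1 "lead_coeff f"] by auto
  show ?case
  proof (cases "m = 0")
    case True
    then obtain a where "f = [:a:]" unfolding m_def by (metis degree_eq_zeroE)
    moreover from this b have "a = b ^ ?p" by simp
    ultimately show ?thesis by (intro exI[of _ "[:b:]"]) (simp add: poly_const_pow)
  next
    case False
    have "coeff (pderiv f) (m - 1) = 0" using less.prems by simp
    hence "of_nat m * lead_coeff f = 0" using False by (simp add: coeff_pderiv m_def)
    moreover have "lead_coeff f \<noteq> 0" using False by (auto simp: m_def)
    ultimately have "?p dvd m" by (simp add: of_nat_eq_0_iff_char_dvd)
    then obtain l where l: "m = ?p * l" by blast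
    define g where "g = monom b l"
    have gp: "g ^ ?p = monom (lead_coeff f) m"
      unfolding g_def by (simp add: monom_power b l mult.commute)
    define f' where "f' = f - g ^ ?p"
    have "degree f' < degree f"
    proof (rule degree_lessI)
      show "f' \<noteq> 0 \<or> 0 < degree f" using False m_def by simp
      show "\<forall>k\<ge>degree f. coeff f' k = 0"
        unfolding f'_def gp by (auto simp: m_def coeff_eq_0 coeff_monom le_less)
    qed
    moreover have "pderiv f' = 0"
      unfolding f'_def by (simp add: pderiv_diff less.prems pderiv_power_char)
    ultimately obtain g' where g': "f' = g' ^ ?p" using less.hyps by blast
    have "f = g' ^ ?p + g ^ ?p" using g' by (simp add: f'_def diff_eq_eq)
    also have "\<dots> = (g' + g) ^ ?p" using frobenius_poly(1)[of g' g 1] by simp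
    finally show ?thesis by blast
  qed
qed

text \<open>Roots of order \<open>CHAR('a)\<close> are extracted until the derivative is nonzero;
  each extraction lowers the degree.\<close>

lemma power_of_separable:
  fixes f :: "'a::{field,finite} poly"
  assumes "degree f > 0"
  shows "\<exists>g k. f = g ^ (CHAR('a) ^ k) \<and> pderiv g \<noteq> 0"
  using assms
proof (induction "degree f" arbitrary: f rule: less_induct)
  case less
  let ?p = "CHAR('a)"
  show ?case
  proof (cases "pderiv f = 0")
    case False
    thus ?thesis by (intro exI[of _ f] exI[of _ 0]) simp
  next
    case True
    then obtain g where g: "f = g ^ ?p" using pderiv_eq_0_imp_power by blast
    have "g \<noteq> 0" using g less.prems by (auto simp: power_0_left split: if_splits)
    hence d: "degree f = ?p * degree g" using g by (simp add: degree_power_eq)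
    have "degree g > 0" using d less.prems by (cases "degree g") auto
    moreover have "1 < ?p" using prime_CHAR_finite_field[where 'a='a] prime_gt_1_nat by blast
    ultimately have "degree g < degree f" using d by simp
    then obtain h k where "g = h ^ (?p ^ k)" "pderiv h \<noteq> 0"
      using less.hyps \<open>degree g > 0\<close> by blast
    thus ?thesis using g by (intro exI[of _ h] exI[of _ "Suc k"]) (auto simp: power_mult[symmetric] mult.commute)
  qed
qed

lemma order_power_eq:
  fixes f :: "'b::idom poly"
  assumes "f \<noteq> 0"
  shows "order a (f ^ n) = n * order a f"
  using assms by (induction n) (simp_all add: order_mult)


section \<open>Stepanov's method\<close>

text \<open>Differentiation lowers a positive order \<open>m\<close> below the characteristic by
  exactly one, because \<open>of_nat m\<close> is then nonzero. Up to that bound, vanishing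
  derivatives detect multiplicity.\<close>

lemma linear_factor_power_dvdI:
  fixes F :: "'b::idom poly"
  assumes "\<And>l. l < M \<Longrightarrow> poly ((pderiv ^^ l) F) x = 0" "M \<le> CHAR('b)"
  shows "[:- x, 1:] ^ M dvd F"
  using assms
proof (induction M arbitrary: F)
  case 0
  thus ?case by simp
next
  case (Suc M)
  have IH: "[:- x, 1:] ^ M dvd pderiv F"
  proof (rule Suc.IH)
    fix l assume "l < M"
    thus "poly ((pderiv ^^ l) (pderiv F)) x = 0"
      using Suc.prems(1)[of "Suc l"] by (simp add: funpow_swap1)
  qed (use Suc.prems in auto)
  show ?case
  proof (cases "F = 0")
    case False
    define m where "m = order x F"
    obtain G where G: "F = [:- x, 1:] ^ m * G" "\<not> [:- x, 1:] dvd G"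
      using order_decomp[OF False] unfolding m_def by blast
    have "poly F x = 0" using Suc.prems(1)[of 0] by simp
    hence "m > 0" using False by (simp add: m_def order_gt_0_iff)
    then obtain m' where m': "m = Suc m'" using gr0_implies_Suc by blast
    have "Suc M \<le> m"
    proof (rule ccontr)
      assume "\<not> Suc M \<le> m"
      hence mM: "m \<le> M" by simp
      have "pderiv F = [:- x, 1:] ^ m' * (smult (of_nat m) G + [:- x, 1:] * pderiv G)"
        unfolding G(1) m' pderiv_mult pderiv_power_Suc
        by (simp add: pderiv_pCons algebra_simps)
      moreover have "[:- x, 1:] ^ m' * [:- x, 1:] dvd pderiv F"
        using IH mM m' by (metis dvd_trans le_imp_power_dvd power_Suc2)
      ultimately have "[:- x, 1:] dvd smult (of_nat m) G + [:- x, 1:] * pderiv G"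
        by (metis dvd_mult_cancel_left pCons_eq_0_iff power_not_zero zero_neq_one)
      hence "poly (smult (of_nat m) G + [:- x, 1:] * pderiv G) x = 0"
        by (simp only: poly_eq_0_iff_dvd)
      hence "of_nat m * poly G x = 0" by simp
      moreover have "poly G x \<noteq> 0" using G(2) by (simp add: poly_eq_0_iff_dvd)
      moreover have "of_nat m \<noteq> (0::'b)"
        using \<open>m > 0\<close> mM Suc.prems(2) by (auto simp: of_nat_eq_0_iff_char_dvd dest: dvd_imp_le)
      ultimately show False by simp
    qed
    thus ?thesis by (simp add: order_divides m_def del: power_Suc)
  qed simp
qed

text \<open>Among the terms with nonzero coefficient, one has strictly smallest order at
  \<open>a\<close>, and nothing can cancel it.\<close>

lemma sum_distinct_order_nonzero:
  fixes U :: "'i \<Rightarrow> 'b::idom poly"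
  assumes "finite B" "\<And>b. b \<in> B \<Longrightarrow> U b \<noteq> 0" "inj_on (\<lambda>b. order a (U b)) B" "b1 \<in> B" "x b1 \<noteq> 0"
  shows "(\<Sum>b\<in>B. smult (x b) (U b)) \<noteq> 0"
proof
  assume eq0: "(\<Sum>b\<in>B. smult (x b) (U b)) = 0"
  define P where "P = (\<lambda>b. b \<in> B \<and> x b \<noteq> 0)"
  define b0 where "b0 = arg_min (\<lambda>b. order a (U b)) P"
  define n where "n = order a (U b0)"
  have P0: "P b0" unfolding b0_def using assms(4,5) by (intro arg_min_natI[of P b1]) (simp add: P_def)
  have min: "n \<le> order a (U b)" if "P b" for b
    unfolding n_def b0_def using that by (rule arg_min_nat_le)
  have b0: "b0 \<in> B" "x b0 \<noteq> 0" using P0 by (auto simp: P_def)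
  have "[:- a, 1:] ^ Suc n dvd smult (x b) (U b)" if "b \<in> B - {b0}" for b
  proof (cases "x b = 0")
    case False
    hence "n \<le> order a (U b)" using that by (intro min) (simp add: P_def)
    moreover have "n \<noteq> order a (U b)"
      using that b0 assms(3) unfolding n_def by (auto dest: inj_onD)
    ultimately show ?thesis using False assms(2) that by (simp add: order_divides order_smult del: power_Suc)
  qed simp
  hence "[:- a, 1:] ^ Suc n dvd (\<Sum>b\<in>B - {b0}. smult (x b) (U b))" by (rule dvd_sum)
  moreover have "smult (x b0) (U b0) = - (\<Sum>b\<in>B - {b0}. smult (x b) (U b))"
    using eq0 b0(1) assms(1) by (simp add: sum.remove[of B b0] eq_neg_iff_add_eq_0)
  ultimately have "[:- a, 1:] ^ Suc n dvd smult (x b0) (U b0)" by (metis dvd_minus_iff)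
  thus False using b0 assms(2)[OF b0(1)] by (simp add: order_divides order_smult n_def del: power_Suc)
qed

text \<open>Pigeonhole over the finite field: two vectors of unknowns have the same image, and their
  difference is a solution.\<close>

lemma underdetermined_system:
  fixes m :: "'i \<Rightarrow> 'j \<Rightarrow> 'a::{field,finite}"
  assumes "finite I" "finite J" "card J < card I"
  shows "\<exists>x. (\<exists>i\<in>I. x i \<noteq> 0) \<and> (\<forall>j\<in>J. (\<Sum>i\<in>I. x i * m i j) = 0)"
proof -
  define f where "f = (\<lambda>x. restrict (\<lambda>j. \<Sum>i\<in>I. x i * m i j) J)"
  have "(1::nat) < CARD('a)" using card_mono[of UNIV "{0,1::'a}"] by simp
  hence "card (J \<rightarrow>\<^sub>E (UNIV :: 'a set)) < card (I \<rightarrow>\<^sub>E (UNIV :: 'a set))"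
    using assms by (simp add: card_PiE)
  moreover have "f ` (I \<rightarrow>\<^sub>E UNIV) \<subseteq> J \<rightarrow>\<^sub>E UNIV" unfolding f_def by auto
  ultimately have "\<not> inj_on f (I \<rightarrow>\<^sub>E UNIV)"
    using card_inj_on_le[of f "I \<rightarrow>\<^sub>E UNIV" "J \<rightarrow>\<^sub>E UNIV"] assms(2) by (force simp: finite_PiE)
  then obtain x y where xy: "x \<in> I \<rightarrow>\<^sub>E UNIV" "y \<in> I \<rightarrow>\<^sub>E UNIV" "x \<noteq> y" "f x = f y"
    unfolding inj_on_def by blast
  from xy(1-3) obtain i where "i \<in> I" "x i \<noteq> y i" by (metis PiE_ext)
  moreover have "(\<Sum>i\<in>I. (x i - y i) * m i j) = 0" if "j \<in> J" for j
    using fun_cong[OF xy(4), of j] that by (simp add: f_def left_diff_distrib sum_subtractf)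
  ultimately show ?thesis by (intro exI[of _ "\<lambda>i. x i - y i"]) auto
qed

text \<open>The logarithmic derivative of \<open>U\<close> is \<open>g / f\<close>, so each
  differentiation costs one factor \<open>f\<close> and raises the degree of the cofactor by at most
  \<open>k\<close>. The factor \<open>U\<close>, possibly of large degree, stays intact.\<close>

lemma higher_pderiv_power_mult:
  fixes f U g :: "'b::idom poly"
  assumes "f * pderiv U = U * g" "degree f \<le> Suc k" "degree g \<le> k" "l \<le> M"
  shows "\<exists>c. degree c \<le> l * k \<and> (pderiv ^^ l) (f ^ M * U) = f ^ (M - l) * U * c"
  using assms(4)
proof (induction l)
  case 0
  show ?case by (intro exI[of _ 1]) simp
next
  case (Suc l)
  then obtain c where c: "degree c \<le> l * k" "(pderiv ^^ l) (f ^ M * U) = f ^ (M - l) * U * c"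
    by auto
  obtain N where N: "M - l = Suc N" using Suc.prems by (metis Suc_diff_Suc Suc_le_lessD)
  hence N': "M - Suc l = N" by simp
  define c' where "c' = smult (of_nat (Suc N)) (pderiv f * c) + g * c + f * pderiv c"
  have "degree (pderiv f) \<le> k"
    using assms(2) by (intro degree_le) (auto simp: coeff_pderiv coeff_eq_0)
  hence 1: "degree (pderiv f * c) \<le> k + l * k" "degree (g * c) \<le> k + l * k"
    using c(1) assms(3) degree_mult_le[of "pderiv f" c] degree_mult_le[of g c] by linarith+
  have 2: "degree (f * pderiv c) \<le> k + l * k"
  proof (cases "degree c = 0")
    case True
    then obtain a where "c = [:a:]" by (metis degree_eq_zeroE)
    thus ?thesis by simp
  next
    case False
    have "degree (pderiv c) \<le> degree c - 1"
      by (intro degree_le) (auto simp: coeff_pderiv coeff_eq_0)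
    thus ?thesis using False c(1) assms(2) degree_mult_le[of f "pderiv c"] by linarith
  qed
  have "degree c' \<le> Suc l * k"
    unfolding c'_def using 1 2 by (intro degree_add_le order.trans[OF degree_smult_le]) auto
  moreover have "(pderiv ^^ Suc l) (f ^ M * U) = f ^ N * U * c'"
  proof -
    have "(pderiv ^^ Suc l) (f ^ M * U) = pderiv (f ^ Suc N * U * c)"
      using c(2) N by simp
    also have "\<dots> = f ^ N * (smult (of_nat (Suc N)) (pderiv f * c) * U + (f * pderiv U) * c + f * pderiv c * U)"
      unfolding pderiv_mult pderiv_power_Suc by (simp add: algebra_simps smult_add_left)
    also have "\<dots> = f ^ N * U * c'"
      unfolding assms(1) c'_def by (simp add: algebra_simps)
    finally show ?thesis .
  qed
  ultimately show ?case using N' by auto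
qed

lemma base_digits_sum:
  fixes n b :: nat
  shows "(\<Sum>h<k. (n div b ^ h mod b) * b ^ h) = n mod b ^ k"
proof (induction k)
  case (Suc k)
  thus ?case
    using mod_mult2_eq[of n "b ^ k" b] by (simp add: algebra_simps)
qed simp

text \<open>\<open>g\<close> is the numerator of the logarithmic derivative, the sum of the
  \<open>\<epsilon> h / (X + \<theta> h)\<close>, over the common denominator \<open>f\<close>. This
  is the relation that \<open>higher_pderiv_power_mult\<close> asks for.\<close>

lemma pderiv_prod_linear_powers:
  fixes \<theta> :: "nat \<Rightarrow> 'b::idom" and \<epsilon> :: "nat \<Rightarrow> nat" and k :: nat
  defines "f \<equiv> \<Prod>h<Suc k. [:\<theta> h, 1:]"
  defines "U \<equiv> \<Prod>h<Suc k. [:\<theta> h, 1:] ^ \<epsilon> h"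
  shows "\<exists>g. f * pderiv U = U * g \<and> degree g \<le> k"
proof -
  let ?A = "{..<Suc k}"
  define g where "g = (\<Sum>h\<in>?A. of_nat (\<epsilon> h) * (\<Prod>j\<in>?A - {h}. [:\<theta> j, 1:]))"
  have lin_gen: "L * pderiv (L ^ e) = of_nat e * L ^ e" if "pderiv L = 1" for L :: "'b poly" and e
    using that by (cases e) (simp_all add: pderiv_power_Suc of_nat_poly del: power_Suc, simp)
  have lin: "[:\<theta> h, 1:] * pderiv ([:\<theta> h, 1:] ^ e) = of_nat e * [:\<theta> h, 1:] ^ e" for h e
    by (rule lin_gen) (simp add: pderiv_pCons)
  have "f * pderiv U = (\<Sum>h\<in>?A. f * ((\<Prod>j\<in>?A - {h}. [:\<theta> j, 1:] ^ \<epsilon> j) * pderiv ([:\<theta> h, 1:] ^ \<epsilon> h)))"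
    unfolding U_def pderiv_prod by (simp add: sum_distrib_left del: prod.lessThan_Suc sum.lessThan_Suc)
  also have "\<dots> = (\<Sum>h\<in>?A. U * (of_nat (\<epsilon> h) * (\<Prod>j\<in>?A - {h}. [:\<theta> j, 1:])))"
  proof (rule sum.cong[OF refl])
    fix h assume h: "h \<in> ?A"
    have f: "f = [:\<theta> h, 1:] * (\<Prod>j\<in>?A - {h}. [:\<theta> j, 1:])"
      unfolding f_def by (rule prod.remove) (use h in auto)
    have U: "U = [:\<theta> h, 1:] ^ \<epsilon> h * (\<Prod>j\<in>?A - {h}. [:\<theta> j, 1:] ^ \<epsilon> j)"
      unfolding U_def by (rule prod.remove) (use h in auto)
    define F' U' where "F' = (\<Prod>j\<in>?A - {h}. [:\<theta> j, 1:])" and "U' = (\<Prod>j\<in>?A - {h}. [:\<theta> j, 1:] ^ \<epsilon> j)"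
    have "f * (U' * pderiv ([:\<theta> h, 1:] ^ \<epsilon> h)) = ([:\<theta> h, 1:] * pderiv ([:\<theta> h, 1:] ^ \<epsilon> h)) * (F' * U')"
      unfolding f F'_def[symmetric] by (simp only: mult_ac)
    also have "\<dots> = U * (of_nat (\<epsilon> h) * F')"
      unfolding lin U U'_def[symmetric] by (simp only: mult_ac)
    finally show "f * ((\<Prod>j\<in>?A - {h}. [:\<theta> j, 1:] ^ \<epsilon> j) * pderiv ([:\<theta> h, 1:] ^ \<epsilon> h)) =
        U * (of_nat (\<epsilon> h) * (\<Prod>j\<in>?A - {h}. [:\<theta> j, 1:]))"
      unfolding F'_def U'_def .
  qed
  also have "\<dots> = U * g" unfolding g_def by (simp add: sum_distrib_left del: sum.lessThan_Suc)
  finally have "f * pderiv U = U * g" .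
  moreover have "degree g \<le> k"
    unfolding g_def
  proof (intro degree_sum_le)
    fix h assume h: "h \<in> ?A"
    have "degree (\<Prod>j\<in>?A - {h}. [:\<theta> j, 1:]) \<le> (\<Sum>j\<in>?A - {h}. degree [:\<theta> j, 1:])"
      using degree_prod_sum_le[of "?A - {h}" "\<lambda>j. [:\<theta> j, 1:]"] by (simp add: o_def)
    also have "\<dots> = k" using h by simp
    finally show "degree (of_nat (\<epsilon> h) * (\<Prod>j\<in>?A - {h}. [:\<theta> j, 1:])) \<le> k"
      using degree_mult_le[of "of_nat (\<epsilon> h)" "\<Prod>j\<in>?A - {h}. [:\<theta> j, 1:]"] by simp
  qed simp
  ultimately show ?thesis by blast
qed


text \<open>
  The auxiliary polynomial is a combination of the products
  \<open>(X + \<theta>)\<^bsup>r + pj\<^esup> W\<^sub>i\<close>, where \<open>W\<^sub>i\<close> is a product of powers of the conjugates \<open>X + \<theta>\<^bsup>p^h\<^esup>\<close> that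
  represents \<open>x \<mapsto> (x + \<theta>)\<^bsup>iE\<^esup>\<close> on the prime field. It is nonzero because these products
  vanish to different orders at \<open>-\<theta>\<close>.
\<close>

lemma not_all_shifts_in_half_of_cosets:
  fixes \<theta> :: "'a::{field,finite}" and \<Omega> :: "'a set"
  defines "p \<equiv> CHAR('a)"
  assumes k: "k \<ge> 4" and E: "E * d = p ^ k - 1" and \<Omega>: "2 * card \<Omega> \<le> d"
    and p_ge: "p \<ge> 2 * (2 * k - 1)\<^sup>2 * d" and d: "d \<ge> 2"
    and \<theta>: "\<And>j. 0 < j \<Longrightarrow> j < k \<Longrightarrow> \<theta> ^ (p ^ j) \<noteq> \<theta>"
    and all: "\<And>y::nat. (of_nat y + \<theta>) ^ E \<in> \<Omega>"
  shows False
proof -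
  have prime: "prime p" unfolding p_def by (rule prime_CHAR_finite_field)
  hence p1: "p > 1" by (rule prime_gt_1_nat)
  obtain k0 where k0: "k = k0 + 4" using k by (metis add.commute le_iff_add)
  define k' where "k' = k0 + 3"
  have kk': "k = Suc k'" by (simp add: k0 k'_def)
  \<comment> \<open>\<open>M\<close> is the multiplicity to be forced at each point of the prime
    field; \<open>J\<close> and \<open>t\<close> count the exponents \<open>j\<close> and
    \<open>r\<close>. Here \<open>t + 1\<close> is \<open>2 * (2 * k - 1)\<^sup>2\<close>, written
    in \<open>k0\<close> to avoid subtraction, and \<open>M = k + J\<close> matters in the final
    comparison.\<close>
  define t M J where "t = 8 * k0 * k0 + 56 * k0 + 97" and "M = 4 * k" and "J = 3 * k"
  have t_d: "(t + 1) * d \<le> p"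
  proof -
    have "2 * (2 * k - 1)\<^sup>2 = t + 1"
      by (simp add: k0 t_def power2_eq_square algebra_simps)
    thus ?thesis using p_ge by simp
  qed
  have t_p: "2 * (t + 1) \<le> p" using t_d d by (metis mult.commute mult_le_mono1 le_trans)
  have MCHAR: "M \<le> CHAR('a)"
    using t_p unfolding M_def t_def k0 p_def by (simp add: algebra_simps)
  define th where "th = (\<lambda>h. \<theta> ^ (p ^ h))"
  have th0: "th 0 = \<theta>" by (simp add: th_def)
  have th_ne: "th h \<noteq> \<theta>" if "0 < h" "h < k" for h using \<theta> that by (simp add: th_def)
  \<comment> \<open>The base \<open>p\<close> digits of \<open>i * E\<close> become exponents of the
    conjugates, as \<open>y + th h\<close> equals \<open>(y + \<theta>) ^ (p ^ h)\<close> for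
    \<open>y\<close> in the prime field. The exponent \<open>r + p * j\<close> is added only at
    \<open>h = 0\<close>, where it is visible in the order at \<open>- \<theta>\<close>.\<close>
  define dig where "dig = (\<lambda>i h. (i * E) div p ^ h mod p)"
  define \<epsilon> where "\<epsilon> = (\<lambda>(i, j, r) h. dig i h + (if h = 0 then r + p * j else 0))"
  define I where "I = {..<d} \<times> {..<J} \<times> {..<t}"
  define U where "U = (\<lambda>b. \<Prod>h<k. [:th h, 1:] ^ \<epsilon> b h)"
  define f where "f = (\<Prod>h<k. [:th h, 1:])"
  have dE: "d * E + 1 = p ^ k" using E p1 by (simp add: mult.commute)
  have iE: "i * E < p ^ k" if "i < d" for i
  proof -
    have "i * E \<le> d * E" using that by simp
    thus ?thesis using dE by linarith
  qed

  have f0: "f \<noteq> 0" unfolding f_def by simp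
  have U0: "U b \<noteq> 0" for b unfolding U_def by simp
  have lin_order: "order (- \<theta>) [:th h, 1:] = (if h = 0 then 1 else 0)" if "h < k" for h
  proof (cases "h = 0")
    case True
    thus ?thesis using order_power_n_n[of "- \<theta>" 1] th0 by simp
  next
    case False
    thus ?thesis using th_ne[of h] that by (simp add: order_0I)
  qed
  have order_U: "order (- \<theta>) (U b) = \<epsilon> b 0" for b
  proof -
    have "order (- \<theta>) (\<Prod>h\<in>H. [:th h, 1:] ^ \<epsilon> b h) = (\<Sum>h\<in>H. \<epsilon> b h * order (- \<theta>) [:th h, 1:])" if "finite H" for H
      using that by (induction H) (simp_all add: order_mult order_power_eq)
    hence "order (- \<theta>) (U b) = (\<Sum>h<k. \<epsilon> b h * order (- \<theta>) [:th h, 1:])" unfolding U_def by blast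
    also have "\<dots> = (\<Sum>h<k. if h = 0 then \<epsilon> b h else 0)"
      by (intro sum.cong) (simp_all add: lin_order)
    also have "\<dots> = \<epsilon> b 0" using kk' by simp
    finally show ?thesis .
  qed
  \<comment> \<open>\<open>d * E\<close> is \<open>- 1\<close> modulo \<open>p\<close>, so the
    lowest digit of \<open>i * E\<close> is \<open>- i / d\<close> modulo \<open>p\<close>.\<close>
  have p_dvd: "p dvd d * dig i 0 + i" if "i < d" for i
  proof -
    have "[d * dig i 0 + i = d * (i * E) + i] (mod p)"
      unfolding dig_def by (intro cong_add cong_scalar_left cong_refl) (simp add: cong_def)
    also have "d * (i * E) + i = i * (d * E + 1)" by (simp add: algebra_simps)
    finally show ?thesis unfolding dE using kk' by (simp add: cong_dvd_iff)
  qed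
  have dig_lt: "dig i h < p" for i h using p1 by (simp add: dig_def)
  \<comment> \<open>No carry occurs: the digit is at most \<open>p - p / d\<close>, and
    \<open>r\<close> is less than \<open>p / d\<close>.\<close>
  have e_r: "dig i 0 + r < p" if ir: "i < d" "r < t" for i r
  proof -
    obtain l where l: "d * dig i 0 + i = p * l" using p_dvd[OF ir(1)] by blast
    have "d * dig i 0 \<le> d * (p - 1)" using dig_lt[of i 0] by (intro mult_left_mono) auto
    hence "p * l < d * (p - 1) + d" using ir l by linarith
    also have "\<dots> = p * d" using p1 by (cases p) (simp_all add: algebra_simps)
    finally have "l < d" using p1 by simp
    hence "l \<le> d - 1" by simp
    hence "p * l \<le> p * (d - 1)" by simp
    hence "d * dig i 0 \<le> p * d - p" using l by (simp add: diff_mult_distrib2)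
    moreover have "d * r < p"
    proof -
      have "d * r \<le> d * t" using ir(2) by simp
      also have "\<dots> < (t + 1) * d" using d by (simp add: algebra_simps)
      finally show ?thesis using t_d by simp
    qed
    moreover have "p \<le> p * d" using d by simp
    ultimately have "d * dig i 0 + d * r < p * d" by linarith
    hence "d * (dig i 0 + r) < d * p" by (simp add: algebra_simps)
    thus ?thesis using d by simp
  qed
  \<comment> \<open>Division of the order by \<open>p\<close> yields \<open>j\<close> and
    \<open>dig i 0 + r\<close>. Multiplying by \<open>d\<close> turns the digits into
    \<open>- i\<close>, and the resulting integer is too small to be a nonzero multiple of
    \<open>p\<close>.\<close>
  have inj: "inj_on (\<lambda>b. \<epsilon> b 0) I"
  proof (rule inj_onI)
    fix b b' assume bb': "b \<in> I" "b' \<in> I" "\<epsilon> b 0 = \<epsilon> b' 0"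
    obtain i j r i' j' r' where b: "b = (i, j, r)" "b' = (i', j', r')" by (metis prod_cases3)
    have lt: "i < d" "i' < d" "r < t" "r' < t" using bb' b by (auto simp: I_def)
    have eq: "(dig i 0 + r) + p * j = (dig i' 0 + r') + p * j'"
      using bb'(3) by (simp add: b \<epsilon>_def add_ac)
    have "((dig i 0 + r) + p * j) mod p = dig i 0 + r" "((dig i' 0 + r') + p * j') mod p = dig i' 0 + r'"
      using e_r lt by simp_all
    hence eq1: "dig i 0 + r = dig i' 0 + r'" using eq by simp
    hence j: "j = j'" using eq p1 by simp
    have eqi: "int (dig i 0) - int (dig i' 0) = int r' - int r" using eq1 by linarith
    have "int p dvd int (d * dig i 0 + i) - int (d * dig i' 0 + i')"
      using p_dvd lt by (intro dvd_diff) (auto simp only: int_dvd_int_iff)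
    also have "int (d * dig i 0 + i) - int (d * dig i' 0 + i') = int d * (int (dig i 0) - int (dig i' 0)) + (int i - int i')"
      by (simp add: algebra_simps)
    also have "\<dots> = int d * (int r' - int r) + (int i - int i')" by (simp add: eqi)
    finally have dvd: "int p dvd int d * (int r' - int r) + (int i - int i')" .
    have "\<bar>int d * (int r' - int r)\<bar> \<le> int d * (int t - 1)"
      unfolding abs_mult using lt by (intro mult_mono) auto
    moreover have "\<bar>int i - int i'\<bar> < int d" using lt by auto
    moreover have "int d * (int t - 1) + int d < int p"
    proof -
      have "int ((t + 1) * d) \<le> int p" using t_d by (rule zle_int[THEN iffD2])
      thus ?thesis using d by (simp add: algebra_simps)
    qed
    ultimately have "\<bar>int d * (int r' - int r) + (int i - int i')\<bar> < int p" by linarith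
    hence "int d * (int r' - int r) + (int i - int i') = 0"
      using dvd zdvd_not_zless[of "\<bar>int d * (int r' - int r) + (int i - int i')\<bar>" "int p"] by (metis abs_ge_zero abs_eq_0 dvd_abs_iff le_less)
    hence 0: "int i' - int i = int d * (int r' - int r)" by simp
    have "int r' - int r = 0"
    proof (rule ccontr)
      assume "int r' - int r \<noteq> 0"
      hence "1 \<le> \<bar>int r' - int r\<bar>" by linarith
      hence "int d \<le> int d * \<bar>int r' - int r\<bar>" using mult_left_mono[of 1 "\<bar>int r' - int r\<bar>" "int d"] by simp
      also have "\<dots> = \<bar>int i' - int i\<bar>" unfolding 0 by (simp add: abs_mult)
      finally show False using lt by linarith
    qed
    with 0 have "i = i'" "r = r'" by simp_all
    thus "b = b'" using b j by simp
  qed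

  have "\<exists>g. f * pderiv (U b) = U b * g \<and> degree g \<le> k'" for b
    unfolding f_def U_def kk' by (rule pderiv_prod_linear_powers)
  then obtain g where g: "f * pderiv (U b) = U b * g b" "degree (g b) \<le> k'" for b by metis
  have deg_f: "degree f = k" unfolding f_def by (simp add: degree_prod_eq_sum_degree)
  have "\<forall>b l. \<exists>c. l \<le> M \<longrightarrow> degree c \<le> l * k' \<and> (pderiv ^^ l) (f ^ M * U b) = f ^ (M - l) * U b * c"
    using higher_pderiv_power_mult[OF g(1) _ g(2)] deg_f kk' by (metis order_refl)
  then obtain C where C: "l \<le> M \<Longrightarrow> degree (C b l) \<le> l * k'"
      "l \<le> M \<Longrightarrow> (pderiv ^^ l) (f ^ M * U b) = f ^ (M - l) * U b * C b l" for b l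
    by metis
  \<comment> \<open>On the prime field \<open>(X + \<theta>) ^ (p * j)\<close> agrees with
    \<open>(X + th 1) ^ j\<close>. Up to a power of \<open>f\<close> and the factor
    \<open>\<omega> ^ i\<close>, \<open>V\<close> is thus a stand-in of low degree for the
    \<open>l\<close>-th derivative of \<open>f ^ M * U b\<close>.\<close>
  define V where "V = (\<lambda>(i, j, r) l. [:\<theta>, 1:] ^ r * [:th 1, 1:] ^ j * C (i, j, r) l)"
  define ind where "ind = (\<lambda>(i::nat, j::nat, r::nat). i)"
  define m where "m = (\<lambda>b (\<omega>, l, c). \<omega> ^ ind b * coeff (V b l) c)"
  \<comment> \<open>One equation for each possible value \<omega> of
    \<open>(y + \<theta>) ^ E\<close>, rather than for each point \<open>y\<close>, each order of
    derivative and each coefficient.\<close>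
  define Cnd where "Cnd = (SIGMA \<omega>:\<Omega>. SIGMA l:{..<M}. {..<t + J + l * k'})"

  \<comment> \<open>For each \<omega> there are fewer than \<open>2 * J * t\<close> equations; as
    \<Omega> has at most \<open>d / 2\<close> elements, the \<open>d * J * t\<close> unknowns
    outnumber them.\<close>
  have "card Cnd < card I"
  proof -
    have "card Cnd = card \<Omega> * (\<Sum>l<M. t + J + l * k')"
      unfolding Cnd_def by (simp add: card_SigmaI)
    moreover have "2 * (\<Sum>l<n. t + J + l * k') + n * k' = 2 * n * (t + J) + n * n * k'" for n
      by (induction n) (simp_all add: algebra_simps)
    from this[of M] have "(\<Sum>l<M. t + J + l * k') < 2 * J * t"
      unfolding M_def J_def k'_def k0 t_def by (simp add: algebra_simps)
    hence "d * (\<Sum>l<M. t + J + l * k') < d * (2 * J * t)" using d by simp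
    moreover have "2 * card \<Omega> * (\<Sum>l<M. t + J + l * k') \<le> d * (\<Sum>l<M. t + J + l * k')"
      using \<Omega> by (rule mult_le_mono1)
    moreover have "d * (2 * J * t) = 2 * (d * J * t)"
      "2 * card \<Omega> * (\<Sum>l<M. t + J + l * k') = 2 * (card \<Omega> * (\<Sum>l<M. t + J + l * k'))" by simp_all
    ultimately have "card Cnd < d * J * t" by linarith
    thus ?thesis by (simp add: I_def algebra_simps)
  qed
  moreover have fin: "finite I" "finite Cnd" unfolding I_def Cnd_def by auto
  ultimately obtain x where x: "\<exists>b\<in>I. x b \<noteq> 0" "\<And>z. z \<in> Cnd \<Longrightarrow> (\<Sum>b\<in>I. x b * m b z) = 0"
    using underdetermined_system[of I Cnd m] by auto
  define F where "F = (\<Sum>b\<in>I. smult (x b) (f ^ M * U b))"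
  have "F = f ^ M * (\<Sum>b\<in>I. smult (x b) (U b))"
    unfolding F_def by (simp add: sum_distrib_left)
  moreover have "(\<Sum>b\<in>I. smult (x b) (U b)) \<noteq> 0"
    using x(1) inj sum_distinct_order_nonzero[OF fin(1), of U "- \<theta>" _ x] by (auto simp: U0 order_U)
  ultimately have F0: "F \<noteq> 0" using f0 by simp

  \<comment> \<open>The low coefficients vanish by the choice of \<open>x\<close>, the others
    because the degree of \<open>V b l\<close> is too small.\<close>
  have kill: "(\<Sum>b\<in>I. smult (x b * \<omega> ^ ind b) (V b l)) = 0" if "\<omega> \<in> \<Omega>" "l < M" for \<omega> l
  proof (rule poly_eqI)
    fix c
    show "coeff (\<Sum>b\<in>I. smult (x b * \<omega> ^ ind b) (V b l)) c = coeff 0 c"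
    proof (cases "c < t + J + l * k'")
      case True
      hence "(\<omega>, l, c) \<in> Cnd" using that by (simp add: Cnd_def)
      from x(2)[OF this] show ?thesis by (simp add: m_def coeff_sum mult.assoc)
    next
      case False
      have "coeff (V b l) c = 0" if b: "b \<in> I" for b
      proof (rule coeff_eq_0)
        obtain i j r where b': "b = (i, j, r)" by (metis prod_cases3)
        have "degree (V b l) \<le> degree ([:\<theta>, 1:] ^ r * [:th 1, 1:] ^ j) + degree (C b l)"
          unfolding V_def b' prod.case by (rule degree_mult_le)
        also have "\<dots> \<le> (r + j) + l * k'"
          using C(1)[of l b] \<open>l < M\<close> by (simp add: degree_mult_eq degree_linear_power)
        also have "\<dots> < c" using False b by (simp add: b' I_def)
        finally show "degree (V b l) < c" .
      qed
      thus ?thesis by (simp add: coeff_sum)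
    qed
  qed

  have vanish: "poly ((pderiv ^^ l) F) (of_nat y) = 0" if l: "l < M" for l and y :: nat
  proof -
    let ?y = "of_nat y :: 'a"
    define \<omega> where "\<omega> = (?y + \<theta>) ^ E"
    have shift: "?y + th h = (?y + \<theta>) ^ (p ^ h)" for h
    proof -
      have "?y ^ (p ^ h) = ?y" for h
        using p1 by (induction y) (simp_all add: power_0_left frobenius_add[OF prime_CHAR_finite_field refl] p_def)
      thus ?thesis using frobenius_add(1)[OF prime_CHAR_finite_field refl, of ?y \<theta> h] by (simp add: th_def p_def)
    qed
    have U_at: "poly (U b) ?y = \<omega> ^ ind b * poly ([:\<theta>, 1:] ^ r * [:th 1, 1:] ^ j) ?y" if b: "b = (i, j, r)" "i < d" for b i j r
    proof -
      have "poly (U b) ?y = (\<Prod>h<k. (?y + th h) ^ \<epsilon> b h)"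
        unfolding U_def by (simp add: poly_prod add.commute)
      also have "\<dots> = (\<Prod>h<k. (?y + \<theta>) ^ (dig i h * p ^ h) * (if h = 0 then (?y + \<theta>) ^ (r + p * j) else 1))"
        unfolding shift by (intro prod.cong) (simp_all add: b \<epsilon>_def power_add power_mult[symmetric] mult.commute)
      also have "\<dots> = (\<Prod>h<k. (?y + \<theta>) ^ (dig i h * p ^ h)) * (?y + \<theta>) ^ (r + p * j)"
        using kk' by (simp add: prod.distrib)
      also have "(\<Prod>h<k. (?y + \<theta>) ^ (dig i h * p ^ h)) = (?y + \<theta>) ^ (\<Sum>h<k. dig i h * p ^ h)"
        by (simp add: power_sum)
      also have "(\<Sum>h<k. dig i h * p ^ h) = i * E"
        unfolding dig_def base_digits_sum using iE[OF b(2)] by simp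
      also have "(?y + \<theta>) ^ (i * E) = \<omega> ^ ind b" by (simp add: \<omega>_def ind_def b power_mult[symmetric] mult.commute)
      also have "(?y + \<theta>) ^ (r + p * j) = poly ([:\<theta>, 1:] ^ r * [:th 1, 1:] ^ j) ?y"
        using shift[of 1] by (simp add: power_add power_mult add.commute)
      finally show ?thesis .
    qed
    \<comment> \<open>Up to a power of \<open>f\<close>, the derivative takes the same value at
      \<open>y\<close> as the polynomial that \<open>kill\<close> makes zero for this
      \<omega>.\<close>
    have "(pderiv ^^ l) F = (\<Sum>b\<in>I. smult (x b) (f ^ (M - l) * U b * C b l))"
      unfolding F_def higher_pderiv_sum higher_pderiv_smult using C(2)[of l] l by simp
    hence "poly ((pderiv ^^ l) F) ?y = poly f ?y ^ (M - l) * (\<Sum>b\<in>I. x b * (poly (U b) ?y * poly (C b l) ?y))"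
      by (simp add: poly_sum sum_distrib_left mult_ac)
    also have "(\<Sum>b\<in>I. x b * (poly (U b) ?y * poly (C b l) ?y)) = poly (\<Sum>b\<in>I. smult (x b * \<omega> ^ ind b) (V b l)) ?y"
      unfolding poly_sum
    proof (intro sum.cong refl)
      fix b assume "b \<in> I"
      then obtain i j r where b: "b = (i, j, r)" "i < d" by (auto simp: I_def)
      show "x b * (poly (U b) ?y * poly (C b l) ?y) = poly (smult (x b * \<omega> ^ ind b) (V b l)) ?y"
        unfolding U_at[OF b] by (simp add: V_def b(1) mult_ac)
    qed
    also have "\<dots> = 0"
      using kill[of \<omega> l] all[of y] l by (simp add: \<omega>_def)
    finally show ?thesis by simp
  qed

  define Y where "Y = (of_nat :: nat \<Rightarrow> 'a) ` {..<p}"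
  have card_Y: "card Y = p"
  proof -
    have "inj_on (of_nat :: nat \<Rightarrow> 'a) {..<p}"
      by (rule inj_onI) (simp add: of_nat_eq_iff_cong_CHAR cong_def p_def)
    thus ?thesis by (simp add: Y_def card_image)
  qed
  have ord_Y: "M \<le> order y F" if y: "y \<in> Y" for y
  proof -
    obtain z :: nat where z: "y = of_nat z" using y by (auto simp: Y_def)
    have "[:- y, 1:] ^ M dvd F"
      unfolding z by (rule linear_factor_power_dvdI[OF vanish MCHAR])
    thus ?thesis using F0 by (simp add: order_divides)
  qed
  have Y_roots: "Y \<subseteq> {y. poly F y = 0}"
  proof
    fix y assume "y \<in> Y"
    from ord_Y[OF this] have "order y F \<noteq> 0" using k by (simp add: M_def)
    thus "y \<in> {y. poly F y = 0}" by (simp add: order_root)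
  qed
  have "p * M = (\<Sum>y\<in>Y. M)" by (simp add: card_Y)
  also have "\<dots> \<le> (\<Sum>y\<in>Y. order y F)" using ord_Y by (rule sum_mono)
  also have "\<dots> \<le> (\<Sum>y | poly F y = 0. order y F)"
    using F0 Y_roots by (intro sum_mono2 poly_roots_finite) auto
  also have "\<dots> \<le> degree F" using F0 by (rule sum_order_le_degree)
  also have "\<dots> \<le> k * M + (k * (p - 1) + (t - 1) + p * (J - 1))"
    unfolding F_def
  proof (intro degree_sum_le fin(1) order.trans[OF degree_smult_le])
    fix b assume "b \<in> I"
    then obtain i j r where b: "b = (i, j, r)" "i < d" "j < J" "r < t" by (auto simp: I_def)
    have "degree (U b) \<le> (\<Sum>h<k. \<epsilon> b h)"
      unfolding U_def by (simp add: degree_prod_eq_sum_degree degree_linear_power)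
    also have "\<dots> = (\<Sum>h<k. dig i h) + (r + p * j)"
      unfolding b \<epsilon>_def using kk' by (simp add: sum.distrib)
    also have "(\<Sum>h<k. dig i h) \<le> (\<Sum>h<k. p - 1)"
      using dig_lt by (intro sum_mono) (metis Suc_pred' less_Suc_eq_le p1 less_trans zero_less_one)
    also have "(\<Sum>h<k. p - 1) = k * (p - 1)" by simp
    finally have "degree (U b) \<le> k * (p - 1) + (r + p * j)" by simp
    moreover have "p * j \<le> p * (J - 1)" using b by (intro mult_le_mono2) auto
    moreover have "r \<le> t - 1" using b by simp
    moreover have "degree (f ^ M) = k * M" using f0 deg_f by (simp add: degree_power_eq)
    ultimately show "degree (f ^ M * U b) \<le> k * M + (k * (p - 1) + (t - 1) + p * (J - 1))"
      using degree_mult_le[of "f ^ M" "U b"] by linarith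
  qed
  finally have le: "p * M \<le> k * M + (k * (p - 1) + (t - 1) + p * (J - 1))" .
  \<comment> \<open>As \<open>M = k + J\<close>, all multiples of \<open>p\<close> but one cancel.
    What remains bounds \<open>p\<close> by less than \<open>k * M + t\<close>, which contradicts
    \<open>2 * (t + 1) \<le> p\<close>.\<close>
  have "p * (J - 1) + p = p * J" "k * (p - 1) + k = k * p"
    using k p1 by (simp_all add: J_def diff_mult_distrib2)
  hence "p * M + p + k + 1 \<le> k * M + k * p + t + p * J"
    using le k by (simp add: t_def)
  hence "p + k + 1 \<le> k * M + t" by (simp add: M_def J_def algebra_simps)
  thus False using t_p by (simp add: M_def k0 t_def algebra_simps)
qed

section \<open>Fully reducible lacunary polynomials\<close>

definition splits :: "'b::idom poly \<Rightarrow> bool"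
  where "splits f \<longleftrightarrow> size (proots f) = degree f"

lemma splits_mult_iff:
  assumes "f \<noteq> 0" "g \<noteq> 0"
  shows "splits (f * g) \<longleftrightarrow> splits f \<and> splits g"
proof -
  have "size (proots (f * g)) = size (proots f) + size (proots g)"
    using assms by (simp add: proots_mult)
  moreover have "degree (f * g) = degree f + degree g" using assms by (simp add: degree_mult_eq)
  moreover have "size (proots f) \<le> degree f" "size (proots g) \<le> degree g"
    by (rule size_proots_le)+
  ultimately show ?thesis unfolding splits_def by linarith
qed

lemma splits_prod_linear: "splits (\<Prod>a\<in>S. [:- (w a), 1::'b::idom:])"
proof (induction S rule: infinite_finite_induct)
  case (insert x F)
  have "(\<Prod>a\<in>F. [:- w a, 1:]) \<noteq> 0" using insert(1) by simp
  moreover have "splits [:- w x, 1:]" by (simp add: splits_def)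
  ultimately show ?case
    unfolding prod.insert[OF insert(1,2)] using insert(3) by (subst splits_mult_iff) auto
qed (simp_all add: splits_def)

lemma splits_power:
  assumes "f \<noteq> 0" "0 < s" "splits (f ^ s)"
  shows "splits f"
  using assms by (cases s) (auto simp: splits_mult_iff)

lemma splits_induct [consumes 2, case_names const root]:
  fixes f :: "'b::field poly"
  assumes "splits f" "f \<noteq> 0"
    and "\<And>c. c \<noteq> 0 \<Longrightarrow> P [:c:]"
    and "\<And>w g. splits g \<Longrightarrow> g \<noteq> 0 \<Longrightarrow> P g \<Longrightarrow> P ([:- w, 1:] * g)"
  shows "P f"
  using assms(1,2)
proof (induction "degree f" arbitrary: f)
  case 0
  thus ?case by (metis assms(3) degree_eq_zeroE pCons_eq_0_iff)
next
  case (Suc d)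
  hence "proots f \<noteq> {#}" by (auto simp: splits_def)
  then obtain w where "w \<in># proots f" by blast
  hence "poly f w = 0" using Suc.prems by simp
  then obtain g where g: "f = [:- w, 1:] * g" by (metis poly_eq_0_iff_dvd dvdE)
  have "g \<noteq> 0" using g Suc.prems by auto
  moreover have "splits g" using Suc.prems g \<open>g \<noteq> 0\<close> by (metis splits_mult_iff pCons_eq_0_iff zero_neq_one)
  moreover have "degree f = degree [:- w, 1:] + degree g"
    unfolding g by (rule degree_mult_eq) (use \<open>g \<noteq> 0\<close> in auto)
  hence "d = degree g" using Suc.hyps(2) by simp
  ultimately show ?case unfolding g using assms(4) Suc.hyps(1) by blast
qed

text \<open>A root of \<open>f\<close> of multiplicity \<open>m\<close> is a root of the derivative
  of multiplicity at least \<open>m - 1\<close>, and \<Phi> supplies the missing factor.\<close>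

lemma splits_dvd_mult_pderiv:
  fixes f :: "'b::field poly"
  assumes "splits f" "f \<noteq> 0" "\<And>w. poly f w = 0 \<Longrightarrow> poly \<Phi> w = 0"
  shows "f dvd \<Phi> * pderiv f"
  using assms
proof (induction rule: splits_induct)
  case (const c)
  thus ?case by simp
next
  case (root w g)
  have "g dvd \<Phi> * pderiv g" using root by simp
  moreover have "[:- w, 1:] dvd \<Phi>" using root(4)[of w] by (simp add: poly_eq_0_iff_dvd)
  moreover have "\<Phi> * pderiv ([:- w, 1:] * g) = \<Phi> * g + [:- w, 1:] * (\<Phi> * pderiv g)"
    unfolding pderiv_mult by (simp add: pderiv_pCons algebra_simps)
  ultimately show ?case by (metis dvd_add mult_dvd_mono dvd_refl)
qed

lemma splits_sum_order:
  fixes f :: "'b::field poly"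
  assumes "splits f" "f \<noteq> 0" "finite W" "{w. poly f w = 0} \<subseteq> W"
  shows "(\<Sum>w\<in>W. order w f) = degree f"
proof -
  have "(\<Sum>w\<in>W. order w f) = (\<Sum>w\<in>{w. poly f w = 0}. order w f)"
    using assms by (intro sum.mono_neutral_right) (auto simp: order_root)
  also have "\<dots> = size (proots f)" using assms(2) by (simp add: size_multiset_overloaded_eq)
  finally show ?thesis using assms(1) by (simp add: splits_def)
qed

section \<open>Factorization and descent for lacunary polynomials\<close>

lemma degree_pderiv_le: "degree (pderiv f) \<le> degree f - 1"
  by (intro degree_le) (auto simp: coeff_pderiv coeff_eq_0)

lemma degree_pderiv_less: "pderiv f \<noteq> 0 \<Longrightarrow> degree (pderiv f) < degree f"
  by (metis degree_pderiv_le degree_eq_zeroE diff_less le_less_trans less_one not_gr_zero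
      pderiv_singleton)

lemma pderiv_monom_char: "CHAR('b::idom) dvd m \<Longrightarrow> pderiv (monom (1::'b) m) = 0"
  using of_nat_eq_0_iff_char_dvd[of m, where 'a='b] by (simp add: pderiv_monom)

text \<open>
  A fully reducible lacunary polynomial \<open>h = X\<^bsup>Q\<^esup> + v\<close> divides \<open>(X - t v\<^sup>s) v'\<close>. Differentiating this
  relation and comparing degrees shows that the cofactor is \<open>1\<close>.
\<close>

lemma lacunary_factorization:
  fixes h :: "'a::{field,finite} poly" and t :: 'a and e j :: nat
  defines "s \<equiv> CHAR('a) ^ e" and "Q \<equiv> CHAR('a) ^ j"
  defines "v \<equiv> h - monom 1 Q"
  assumes e: "e \<ge> 1" and j: "j \<ge> 1" and s5: "s \<ge> 5"
    and h: "degree h = Q" "splits h" "pderiv h \<noteq> 0"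
    and roots: "\<And>w. poly h w = 0 \<Longrightarrow> t * w ^ (s * Q) + w = 0"
    and deg: "(s - 1) * (s * degree v + 1) \<le> s * Q - 1"
  shows "h = ([:0, 1:] - smult t (v ^ s)) * pderiv v"
    and "pderiv (pderiv v) = 0"
    and "pderiv ([:0, 1:] - smult t (v ^ s)) = 1"
    and "\<And>w. poly h w = 0 \<Longrightarrow> poly ([:0, 1:] - smult t (v ^ s)) w = 0"
proof -
  let ?p = "CHAR('a)"
  have p: "prime ?p" by (rule prime_CHAR_finite_field)
  have p_dvd: "?p dvd s" "?p dvd Q" using e j by (auto simp: s_def Q_def dvd_power)
  have h0: "h \<noteq> 0" using h by auto
  have hv: "h = monom 1 Q + v" by (simp add: v_def)
  define \<Psi> where "\<Psi> = [:0, 1:] - smult t (v ^ s)"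
  have d\<Psi>: "pderiv \<Psi> = 1"
    using p_dvd(1) by (simp add: \<Psi>_def pderiv_diff pderiv_smult pderiv_power_char pderiv_pCons)
  have dh: "pderiv h = pderiv v"
    using p_dvd(2) by (simp add: hv pderiv_add pderiv_monom_char)
  hence v'0: "pderiv v \<noteq> 0" using h by simp
  have r0: "degree v > 0" using degree_pderiv_less[OF v'0] by simp
  \<comment> \<open>All roots of \<open>h\<close> are roots of \<Phi>. Subtracting a multiple of
    \<open>h ^ s\<close> leaves \<Psi>, whose degree is much smaller.\<close>
  define \<Phi> where "\<Phi> = monom t (s * Q) + [:0, 1:]"
  have hs: "h ^ s = monom 1 (s * Q) + v ^ s"
    unfolding hv s_def frobenius_poly by (simp add: monom_power mult.commute)
  have \<Phi>: "\<Phi> = smult t (h ^ s) + \<Psi>"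
    unfolding hs \<Phi>_def \<Psi>_def by (simp add: smult_add_right smult_monom)
  have s0: "s > 0" using s5 by simp
  have root\<Phi>: "poly \<Phi> w = 0" if "poly h w = 0" for w
    using roots[OF that] by (simp add: \<Phi>_def poly_monom)
  show root\<Psi>: "poly ([:0, 1:] - smult t (v ^ s)) w = 0" if "poly h w = 0" for w
    using root\<Phi>[OF that] that s0 unfolding \<Phi> \<Psi>_def[symmetric] by (simp add: power_0_left)
  have "h dvd \<Psi> * pderiv v"
    using splits_dvd_mult_pderiv[OF h(2) h0, of \<Psi>] root\<Psi> unfolding \<Psi>_def[symmetric] dh by blast
  then obtain u where u: "\<Psi> * pderiv v = h * u" by blast

  define r where "r = degree v"
  have deg\<Psi>: "degree \<Psi> \<le> s * r"
  proof -
    have "degree (v ^ s) = s * r" using r0 by (subst degree_power_eq) (auto simp: r_def)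
    moreover have "1 \<le> s * r" using r0 s0 by (simp add: r_def)
    ultimately show ?thesis unfolding \<Psi>_def
      by (intro degree_diff_le order.trans[OF degree_smult_le]) auto
  qed
  have deg_v': "degree (pderiv v) \<le> r - 1" unfolding r_def by (rule degree_pderiv_le)
  \<comment> \<open>The degree hypothesis divided by \<open>s\<close>:
    \<open>(s - 1) * (s * r + 1) + 1\<close> equals \<open>s * ((s - 1) * r + 1)\<close>.\<close>
  have rQ: "(s - 1) * r + 1 \<le> Q"
  proof -
    have "1 \<le> s * Q" using s0 prime_gt_0_nat[OF p] by (simp add: Q_def Suc_le_eq)
    hence "(s - 1) * (s * r + 1) + 1 \<le> s * Q" using deg unfolding r_def by linarith
    moreover have "(s - 1) * (s * r + 1) + 1 = s * ((s - 1) * r + 1)"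
      using s0 by (cases s) (simp_all add: algebra_simps)
    ultimately have "s * ((s - 1) * r + 1) \<le> s * Q" by linarith
    thus ?thesis using s0 by (simp only: mult_le_cancel1)
  qed
  have "u \<noteq> 0" using u d\<Psi> v'0 by auto
  hence degu: "Q + degree u \<le> s * r + (r - 1)"
    using arg_cong[OF u, of degree] degree_mult_le[of \<Psi> "pderiv v"] deg\<Psi> deg_v' h0
    by (simp add: degree_mult_eq h)
  \<comment> \<open>The derivative of \<open>\<Psi> * pderiv v = h * u\<close>, multiplied by
    \<open>pderiv v\<close> so that \<Psi> can be eliminated.\<close>
  have key: "pderiv v ^ 2 * (1 - u) = h * (pderiv u * pderiv v - u * pderiv (pderiv v))"
  proof -
    have "pderiv v + \<Psi> * pderiv (pderiv v) = pderiv v * u + h * pderiv u"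
      using arg_cong[OF u, of pderiv] by (simp add: pderiv_mult d\<Psi> dh algebra_simps)
    hence "pderiv v * (pderiv v + \<Psi> * pderiv (pderiv v)) = pderiv v * (pderiv v * u + h * pderiv u)"
      by simp
    thus ?thesis using u by (simp add: algebra_simps power2_eq_square)
        (metis (no_types, lifting) mult.assoc mult.commute)
  qed
  \<comment> \<open>A nonzero multiple of \<open>h\<close> has degree at least \<open>Q\<close>,
    which the left side cannot reach; \<open>s \<ge> 5\<close> gives
    \<open>s + 3 \<le> 2 * (s - 1)\<close>.\<close>
  have "pderiv v ^ 2 * (1 - u) = 0"
  proof (rule ccontr)
    assume nz: "pderiv v ^ 2 * (1 - u) \<noteq> 0"
    have "h dvd pderiv v ^ 2 * (1 - u)" unfolding key by simp
    hence "Q \<le> degree (pderiv v ^ 2 * (1 - u))" using nz h(1) dvd_imp_degree_le by metis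
    also have "\<dots> \<le> degree (pderiv v ^ 2) + degree (1 - u)" by (rule degree_mult_le)
    also have "degree (pderiv v ^ 2) \<le> 2 * (r - 1)"
      using degree_power_le[of "pderiv v" 2] deg_v' by linarith
    also have "degree (1 - u) \<le> degree u" using degree_diff_le[of 1 "degree u" u] by simp
    finally have "Q \<le> 2 * (r - 1) + degree u" by simp
    hence "2 * Q \<le> 2 * (r - 1) + (s * r + (r - 1))" using degu by linarith
    hence "2 * Q + 3 \<le> (s + 3) * r" using r0 by (simp add: r_def algebra_simps)
    moreover have "(s + 3) * r \<le> 2 * ((s - 1) * r)"
    proof -
      have "s + 3 \<le> 2 * (s - 1)" using s5 by simp
      thus ?thesis by (metis mult.assoc mult_le_mono1)
    qed
    ultimately show False using rQ by linarith
  qed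
  hence "u = 1" using v'0 by simp
  thus h_eq: "h = ([:0, 1:] - smult t (v ^ s)) * pderiv v" using u by (simp add: \<Psi>_def)
  show "pderiv ([:0, 1:] - smult t (v ^ s)) = 1" using d\<Psi> by (simp add: \<Psi>_def)
  have "pderiv v = pderiv v + \<Psi> * pderiv (pderiv v)"
    using arg_cong[OF h_eq, of pderiv] unfolding \<Psi>_def[symmetric] by (simp add: pderiv_mult d\<Psi> dh)
  hence "\<Psi> * pderiv (pderiv v) = 0" by simp
  moreover have "\<Psi> \<noteq> 0" using d\<Psi> by auto
  ultimately show "pderiv (pderiv v) = 0" by simp
qed


lemma degree_diff_X_pderiv: "degree (w - [:0, 1:] * pderiv w) \<le> degree (w :: 'b::idom poly)"
proof -
  have "degree ([:0, 1:] * pderiv w) \<le> degree w"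
  proof (cases "pderiv w = 0")
    case False
    thus ?thesis using degree_pderiv_less[OF False] by (simp add: degree_mult_eq)
  qed simp
  thus ?thesis by (intro degree_diff_le) auto
qed

text \<open>
  Taking \<open>s\<close>-th roots of the relation turns it into one of the same form with \<open>P\<close> and \<open>Q\<close> divided by \<open>s\<close>,
  until \<open>P = s\<close>, where comparing the degrees of the derivatives gives the bound.
\<close>

lemma lacunary_descent:
  fixes \<gamma> w :: "'a::{field,finite} poly" and e i j :: nat
  defines "p \<equiv> CHAR('a)"
  defines "s \<equiv> p ^ e"
  assumes \<gamma>: "pderiv \<gamma> \<noteq> 0" and e: "e \<ge> 1"
    and "i \<ge> 1" "\<tau> \<noteq> 0" "p dvd E" "pderiv w = smult \<kappa> (\<gamma> ^ E)"
    and "smult \<tau> (w ^ s * \<gamma> ^ (p ^ i)) = monom 1 (p ^ j) + (w - [:0, 1:] * pderiv w)"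
  shows "p ^ j \<le> degree \<gamma> * p ^ i * (E + p ^ i + 2)"
  using assms(5-)
proof (induction i arbitrary: w j E \<kappa> \<tau> rule: less_induct)
  case (less i)
  have p2: "p \<ge> 2" using prime_CHAR_finite_field[where 'a='a] prime_ge_2_nat by (auto simp: p_def)
  have p0: "p > 0" using p2 by simp
  define P Q where "P = p ^ i" and "Q = p ^ j"
  have PQ0: "P > 0" "Q > 0" "s > 0" using p0 by (auto simp: P_def Q_def s_def)
  define c where "c = degree \<gamma>"
  have c: "c > 0" using degree_pderiv_less[OF \<gamma>] by (simp add: c_def)
  define D where "D = w - [:0, 1:] * pderiv w"
  define r where "r = degree w"
  have eq: "smult \<tau> (w ^ s * \<gamma> ^ P) = monom 1 Q + D"
    using less.prems(5) by (simp only: P_def Q_def D_def)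
  have degD: "degree D \<le> r" unfolding D_def r_def by (rule degree_diff_X_pderiv)
  have \<gamma>0: "\<gamma> \<noteq> 0" using \<gamma> by auto
  have w0: "w \<noteq> 0"
  proof
    assume "w = 0"
    hence "monom (1::'a) Q = 0" using eq PQ0 by (simp add: D_def power_0_left)
    thus False by simp
  qed
  have degL: "degree (smult \<tau> (w ^ s * \<gamma> ^ P)) = s * r + c * P"
    using less.prems(2) w0 \<gamma>0 by (simp add: degree_mult_eq degree_power_eq r_def c_def mult.commute)
  have cP: "c * P > 0" using c PQ0 by simp
  have rs: "r \<le> s * r" using PQ0 by simp
  have "Q > r"
  proof (rule ccontr)
    assume "\<not> Q > r"
    hence "degree (monom 1 Q + D) \<le> r"
      using degD by (intro degree_add_le order.trans[OF degree_monom_le]) auto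
    thus False using degL eq rs cP by simp
  qed
  hence "degree (monom 1 Q + D) = Q"
    using degD by (subst degree_add_eq_left) (auto simp: degree_monom_eq)
  \<comment> \<open>Only \<open>X ^ Q\<close> carries the degree of the right side, so a bound for
    \<open>r\<close> bounds \<open>Q\<close>.\<close>
  hence Q: "Q = s * r + c * P" using degL eq by simp
  have goal: ?case if "Q \<le> c * P * (E + P + 2)"
    using that by (simp add: P_def Q_def c_def)
  show ?case
  proof (cases "j \<le> i")
    case True
    hence "Q \<le> P * 1" using p0 by (simp add: P_def Q_def power_increasing)
    also have "P * 1 \<le> c * P * (E + P + 2)"
      using c by (intro mult_mono) auto
    finally show ?thesis by (intro goal) simp
  next
    case False
    hence ji: "j > i" by simp
    show ?thesis
    proof (cases "i < e")
      case True
      \<comment> \<open>For \<open>P < s\<close> the \<open>P\<close>-th root \<open>w1\<close> of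
        \<open>D\<close> has degree at most \<open>r\<close>, but its derivative has degree at least
        \<open>r\<close>, which is absurd.\<close>
      define a where "a = p ^ (e - i)"
      have aP: "s = a * P" using True by (simp add: s_def a_def P_def flip: power_add)
      define Q' where "Q' = p ^ (j - i)"
      have Q': "Q = Q' * P" using ji by (simp add: Q_def Q'_def P_def flip: power_add)
      obtain \<sigma> where \<sigma>: "\<sigma> ^ P = \<tau>" unfolding P_def p_def using frobenius_surj by blast
      define w1 where "w1 = smult \<sigma> (w ^ a * \<gamma>) - monom 1 Q'"
      have "w1 ^ P = smult \<tau> (w ^ s * \<gamma> ^ P) - monom 1 Q"
        unfolding w1_def P_def p_def frobenius_poly(2)
        unfolding p_def[symmetric] P_def[symmetric]
        by (simp add: \<sigma> smult_power power_mult_distrib monom_power aP Q' flip: power_mult)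
      hence "w1 ^ P = D" using eq by simp
      hence degw1: "degree w1 * P \<le> r"
        using degD w0 by (cases "w1 = 0") (auto simp: degree_power_eq mult.commute)
      have "CHAR('a) dvd a" "CHAR('a) dvd Q'" using True ji by (auto simp: a_def Q'_def p_def dvd_power)
      hence w1': "pderiv w1 = smult \<sigma> (w ^ a * pderiv \<gamma>)"
        unfolding w1_def by (simp add: pderiv_diff pderiv_smult pderiv_mult pderiv_power_char pderiv_monom_char)
      have \<sigma>0: "\<sigma> \<noteq> 0" using \<sigma> less.prems(2) PQ0 by (auto simp: power_0_left)
      hence w1'0: "pderiv w1 \<noteq> 0" using w1' w0 \<gamma> by simp
      have a0: "a > 0" using p0 by (simp add: a_def)
      have "degree (pderiv w1) = a * r + degree (pderiv \<gamma>)"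
        unfolding w1' using \<sigma>0 w0 \<gamma> by (simp add: degree_mult_eq degree_power_eq r_def)
      moreover have "r \<le> a * r" using a0 by simp
      moreover have "degree w1 \<le> degree w1 * P" using PQ0 by simp
      ultimately have False using degree_pderiv_less[OF w1'0] degw1 by linarith
      thus ?thesis ..
    next
      case ei: False
      \<comment> \<open>For \<open>s \<le> P\<close> the \<open>s\<close>-th root of the whole
        relation can be taken; \<open>w1\<close> is the \<open>s\<close>-th root of
        \<open>D\<close>.\<close>
      define P' where "P' = p ^ (i - e)"
      have P': "P = P' * s" using ei by (simp add: s_def P'_def P_def flip: power_add)
      define Q' where "Q' = p ^ (j - e)"
      have Q': "Q = Q' * s" using ji ei by (simp add: Q_def Q'_def s_def flip: power_add)
      obtain \<sigma> where \<sigma>: "\<sigma> ^ s = \<tau>" unfolding s_def p_def using frobenius_surj by blast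
      have \<sigma>0: "\<sigma> \<noteq> 0" using \<sigma> less.prems(2) PQ0 by (auto simp: power_0_left)
      define w1 where "w1 = smult \<sigma> (w * \<gamma> ^ P') - monom 1 Q'"
      have "w1 ^ s = smult \<tau> (w ^ s * \<gamma> ^ P) - monom 1 Q"
        unfolding w1_def s_def p_def frobenius_poly(2)
        unfolding p_def[symmetric] s_def[symmetric]
        by (simp add: \<sigma> smult_power power_mult_distrib monom_power P' Q' flip: power_mult)
      hence w1s: "w1 ^ s = D" using eq by simp
      hence degw1: "degree w1 * s \<le> r"
        using degD w0 by (cases "w1 = 0") (auto simp: degree_power_eq mult.commute)
      have pQ': "CHAR('a) dvd Q'" using ji ei by (auto simp: Q'_def p_def dvd_power)
      show ?thesis
      proof (cases "i = e")
        case True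
        have P1: "P' = 1" "P = s" using True by (simp_all add: P'_def P_def s_def)
        have w1': "pderiv w1 = smult \<sigma> (smult \<kappa> (\<gamma> ^ (E + 1)) + w * pderiv \<gamma>)"
          unfolding w1_def P1 using pQ'
          by (simp add: pderiv_diff pderiv_smult pderiv_mult pderiv_monom_char less.prems(4) add.commute mult.commute)
        \<comment> \<open>Otherwise \<open>w * pderiv \<gamma>\<close> dominates, and the derivative
          of \<open>w1\<close> has degree at least that of \<open>w1\<close>.\<close>
        have "r \<le> (E + 1) * c"
        proof (rule ccontr)
          assume "\<not> r \<le> (E + 1) * c"
          hence "(E + 1) * c < r" by simp
          moreover have "degree (smult \<kappa> (\<gamma> ^ (E + 1))) \<le> (E + 1) * c"
            using \<gamma>0 by (intro order.trans[OF degree_smult_le]) (simp add: degree_power_eq c_def del: power_Suc)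
          moreover have "r \<le> degree (w * pderiv \<gamma>)" using w0 \<gamma> by (simp add: degree_mult_eq r_def)
          ultimately have deg: "r \<le> degree (smult \<kappa> (\<gamma> ^ (E + 1)) + w * pderiv \<gamma>)"
            by (subst degree_add_eq_right) auto
          hence "r \<le> degree (pderiv w1)" unfolding w1' using \<sigma>0 by simp
          moreover have "degree w1 \<le> degree w1 * s" using PQ0 by simp
          moreover have "pderiv w1 \<noteq> 0" using \<open>r \<le> degree (pderiv w1)\<close> \<open>(E + 1) * c < r\<close> by auto
          ultimately show False using degree_pderiv_less[of w1] degw1 by linarith
        qed
        hence "Q \<le> s * ((E + 1) * c) + c * P" unfolding Q by simp
        also have "\<dots> = c * P * (E + 2)" by (simp add: P1 algebra_simps)
        also have "\<dots> \<le> c * P * (E + P + 2)" by simp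
        finally show ?thesis by (rule goal)
      next
        case False
        hence ei': "e < i" using ei by simp
        hence pP': "CHAR('a) dvd P'" by (auto simp: P'_def p_def dvd_power)
        have w1': "pderiv w1 = smult \<sigma> (pderiv w * \<gamma> ^ P')"
          unfolding w1_def using pQ' pP'
          by (simp add: pderiv_diff pderiv_smult pderiv_mult pderiv_monom_char pderiv_power_char mult.commute)
        \<comment> \<open>\<open>w1\<close> satisfies the same relation with \<open>P\<close> and
          \<open>Q\<close> divided by \<open>s\<close> and with \<open>E + P'\<close> in place of
          \<open>E\<close>. The shape of the bound is preserved because
          \<open>2 * P' \<le> P\<close>.\<close>
        have "p ^ (j - e) \<le> degree \<gamma> * p ^ (i - e) * ((E + P') + p ^ (i - e) + 2)"
        proof (rule less.IH)
          show "i - e < i" "i - e \<ge> 1" using e ei' by simp_all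
          show "\<sigma> \<noteq> 0" by (fact \<sigma>0)
          show "p dvd E + P'" using less.prems(3) pP' by (simp add: p_def)
          show "pderiv w1 = smult (\<sigma> * \<kappa>) (\<gamma> ^ (E + P'))"
            unfolding w1' less.prems(4) by (simp add: power_add)
          show "smult \<sigma> (w1 ^ s * \<gamma> ^ (p ^ (i - e))) = monom 1 (p ^ (j - e)) + (w1 - [:0, 1:] * pderiv w1)"
            unfolding w1s w1' P'_def[symmetric] Q'_def[symmetric]
            unfolding w1_def D_def
            by (simp add: algebra_simps smult_diff_right)
        qed
        hence "Q' \<le> c * P' * (E + 2 * P' + 2)"
          unfolding P'_def[symmetric] Q'_def[symmetric] c_def[symmetric] by (simp add: mult_2 add_ac)
        hence "Q' * s \<le> c * P' * (E + 2 * P' + 2) * s" by (rule mult_le_mono1)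
        also have "\<dots> = c * (P' * s) * (E + 2 * P' + 2)" by (simp only: mult_ac)
        finally have "Q \<le> c * P * (E + 2 * P' + 2)" unfolding Q' P' .
        also have "2 * P' \<le> P"
        proof -
          have "2 \<le> s" using p2 e self_le_power[of p e] by (simp add: s_def)
          thus ?thesis unfolding P' by (metis mult.commute mult_le_mono2)
        qed
        hence "c * P * (E + 2 * P' + 2) \<le> c * P * (E + P + 2)" by simp
        finally show ?thesis by (rule goal)
      qed
    qed
  qed
qed

text \<open>The derivative of \<open>v\<close> is \<gamma> to a power \<open>P\<close> of the
  characteristic, and \<open>P > 1\<close> because the second derivative vanishes. Moving
  \<open>X * pderiv v\<close> to the other side gives the relation of
  \<open>lacunary_descent\<close> with \<open>E = P\<close>. So the roots of the derivative are few
  and of high multiplicity.\<close>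

lemma lacunary_pderiv_multiplicities:
  fixes v :: "'a::{field,finite} poly" and e j :: nat
  defines "s \<equiv> CHAR('a) ^ e" and "Q \<equiv> CHAR('a) ^ j"
  assumes e: "e \<ge> 1" and t: "t \<noteq> 0"
    and eq: "monom 1 Q + v = ([:0, 1:] - smult t (v ^ s)) * pderiv v"
    and v: "pderiv (pderiv v) = 0" "degree (pderiv v) > 0"
  shows "\<exists>P. (\<forall>w. P dvd order w (pderiv v)) \<and> Q \<le> 3 * P * degree (pderiv v)"
proof -
  let ?p = "CHAR('a)"
  have p2: "?p \<ge> 2" using prime_CHAR_finite_field[where 'a='a] prime_ge_2_nat by blast
  obtain \<gamma> i where \<gamma>: "pderiv v = \<gamma> ^ (?p ^ i)" "pderiv \<gamma> \<noteq> 0"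
    using power_of_separable[OF v(2)] by blast
  have i: "i \<ge> 1"
  proof (rule ccontr)
    assume "\<not> i \<ge> 1"
    hence "i = 0" by simp
    thus False using \<gamma> v(1) by simp
  qed
  define P where "P = ?p ^ i"
  have P: "P \<ge> 2" using p2 i self_le_power[of ?p i] by (simp add: P_def)
  have \<gamma>0: "\<gamma> \<noteq> 0" using \<gamma>(2) by auto
  have "Q \<le> degree \<gamma> * ?p ^ i * (P + ?p ^ i + 2)"
    unfolding Q_def
  proof (rule lacunary_descent[where \<tau> = "- t" and \<kappa> = 1 and w = v])
    show "?p dvd P" using i by (simp add: P_def dvd_power)
    show "smult (- t) (v ^ ?p ^ e * \<gamma> ^ (?p ^ i)) = monom 1 (?p ^ j) + (v - [:0, 1:] * pderiv v)"
      using eq unfolding \<gamma>(1)[symmetric] Q_def s_def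
      by (simp add: algebra_simps)
  qed (use \<gamma> e i t in \<open>simp_all add: P_def\<close>)
  also have "\<dots> \<le> degree \<gamma> * P * (3 * P)" using P unfolding P_def[symmetric] by (intro mult_le_mono2) simp
  also have "\<dots> = 3 * P * degree (pderiv v)"
    using \<gamma>0 by (simp add: \<gamma>(1) P_def degree_power_eq)
  finally have "Q \<le> 3 * P * degree (pderiv v)" .
  moreover have "P dvd order w (pderiv v)" for w
    by (simp add: \<gamma>(1) P_def order_power_eq[OF \<gamma>0])
  ultimately show ?thesis by blast
qed

text \<open>The operator \<open>L\<close> measures the failure of additivity; it commutes with
  Frobenius and kills \<open>X\<close> and \<open>X ^ Q\<close>. As the derivative of
  \<open>v\<close> is a constant \<kappa>, \<open>L v\<close> equals \<open>- (\<kappa> * t)\<close>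
  times its own \<open>s\<close>-th power, hence is constant by degrees, and its value at
  \<open>0\<close> is \<open>0\<close>.\<close>

lemma lacunary_roots_add:
  fixes v :: "'a::{field,finite} poly" and e j :: nat
  defines "s \<equiv> CHAR('a) ^ e" and "Q \<equiv> CHAR('a) ^ j"
  defines "h \<equiv> monom 1 Q + v"
  assumes e: "e \<ge> 1"
    and eq: "h = ([:0, 1:] - smult t (v ^ s)) * pderiv v"
    and v: "degree (pderiv v) = 0" and h0: "poly h 0 = 0"
    and x: "poly h x = 0" and y: "poly h y = 0"
  shows "poly h (x + y) = 0"
proof -
  let ?p = "CHAR('a)"
  have p2: "?p \<ge> 2" using prime_CHAR_finite_field[where 'a='a] prime_ge_2_nat by blast
  obtain \<kappa> where \<kappa>: "pderiv v = [:\<kappa>:]" using v by (metis degree_eq_zeroE)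
  define L where "L = (\<lambda>f :: 'a poly. pcompose f [:y, 1:] - f - [:poly f y:])"
  have L_add: "L (f + g) = L f + L g" and L_diff: "L (f - g) = L f - L g"
    and L_smult: "L (smult c f) = smult c (L f)" for f g c
    by (simp_all add: L_def pcompose_add pcompose_diff pcompose_smult smult_diff_right)
  have L_pow: "L (f ^ (?p ^ k)) = L f ^ (?p ^ k)" for f k
  proof -
    have "pcompose (f ^ n) g = pcompose f g ^ n" for n g
      by (induction n) (simp_all add: pcompose_mult pcompose_1)
    thus ?thesis unfolding L_def frobenius_poly(2) by (simp add: poly_const_pow)
  qed
  have L_X: "L [:0, 1:] = 0" by (simp add: L_def pcompose_pCons)
  have X_pow: "monom 1 Q = [:0, 1:] ^ Q" by (simp add: monom_altdef)
  have "L (monom 1 Q) = L [:0, 1:] ^ Q" unfolding X_pow unfolding Q_def by (rule L_pow)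
  also have "\<dots> = 0" unfolding L_X using p2 by (simp add: Q_def)
  finally have L_Q: "L (monom 1 Q) = 0" .
  have "h = smult \<kappa> ([:0, 1:] - smult t (v ^ s))" using eq \<kappa> by simp
  hence "L h = smult \<kappa> (L [:0, 1:] - smult t (L v ^ s))"
    unfolding s_def by (simp only: L_smult L_diff L_pow)
  hence Lv: "L v = smult (- (\<kappa> * t)) (L v ^ s)" by (simp add: h_def L_add L_Q L_X)
  have s2: "s \<ge> 2" using p2 e self_le_power[of ?p e] by (simp add: s_def)
  have "degree (L v) = 0"
  proof (rule ccontr)
    assume nz: "degree (L v) \<noteq> 0"
    hence "L v \<noteq> 0" by auto
    have "- (\<kappa> * t) \<noteq> 0"
    proof
      assume "- (\<kappa> * t) = 0"
      from Lv[unfolded this] have "L v = 0" by simp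
      thus False using \<open>L v \<noteq> 0\<close> by simp
    qed
    hence "degree (smult (- (\<kappa> * t)) (L v ^ s)) = s * degree (L v)"
      using \<open>L v \<noteq> 0\<close> by (simp add: degree_power_eq)
    with arg_cong[OF Lv, of degree] have "degree (L v) = s * degree (L v)" by (rule trans)
    thus False using nz s2 by simp
  qed
  then obtain \<delta> where \<delta>: "L v = [:\<delta>:]" by (metis degree_eq_zeroE)
  have "poly v 0 = 0" using h0 p2 by (simp add: h_def poly_monom Q_def power_0_left)
  hence "poly (L v) 0 = 0" by (simp add: L_def poly_pcompose)
  hence "L v = 0" using \<delta> by simp
  hence "poly (L h) x = 0" by (simp add: h_def L_add L_Q)
  thus ?thesis using x y by (simp add: L_def poly_pcompose add.commute)
qed

section \<open>Sets determining few directions\<close>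

text \<open>Multiplication by a nonzero \<open>x\<close> permutes the nonzero elements of
  \<open>L\<close>, so their product can be compared with itself. This serves the whole field,
  subfields and a subgroup of units with \<open>0\<close> adjoined.\<close>

lemma power_card_eq_self:
  fixes L :: "'b::field set"
  assumes "finite L" "0 \<in> L" "\<And>x y. x \<in> L \<Longrightarrow> y \<in> L \<Longrightarrow> x * y \<in> L" "x \<in> L"
  shows "x ^ card L = x"
proof (cases "x = 0")
  case True
  thus ?thesis using assms by (auto simp: power_0_left)
next
  case False
  let ?L = "L - {0}"
  have "inj_on (\<lambda>y. x * y) ?L" using False by (auto simp: inj_on_def)
  moreover have "(\<lambda>y. x * y) ` ?L \<subseteq> ?L" using assms False by auto
  ultimately have img: "(\<lambda>y. x * y) ` ?L = ?L"
    using assms(1) by (intro endo_inj_surj) auto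
  have "\<Prod>?L = (\<Prod>y\<in>?L. x * y)"
    using prod.reindex[OF \<open>inj_on (\<lambda>y. x * y) ?L\<close>, of id] img by simp
  also have "\<dots> = x ^ card ?L * \<Prod>?L" by (simp add: prod.distrib)
  finally have "\<Prod>?L = x ^ card ?L * \<Prod>?L" .
  from iffD1[OF mult_cancel_right1 this] have "x ^ card ?L = 1" using assms(1) by simp
  moreover have "card L = Suc (card ?L)" using card.remove[OF assms(1,2)] .
  ultimately show ?thesis by simp
qed

lemma card_roots_power_le:
  fixes c :: "'b::idom"
  assumes "m > 0"
  shows "finite {x. x ^ m = c}" "card {x. x ^ m = c} \<le> m"
proof -
  define f where "f = monom 1 m - [:c:]"
  have d: "degree f = m"
    unfolding f_def diff_conv_add_uminus using assms by (subst degree_add_eq_left) (simp_all add: degree_monom_eq)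
  hence "f \<noteq> 0" using assms by auto
  moreover have "{x. x ^ m = c} = {x. poly f x = 0}" by (auto simp: f_def poly_monom)
  ultimately show "finite {x. x ^ m = c}" "card {x. x ^ m = c} \<le> m"
    using poly_roots_finite card_poly_roots_bound d by metis+
qed

lemma card_fixed_power_le:
  assumes "m \<ge> 2"
  shows "card {x::'a::{field,finite}. x ^ m = x} \<le> m"
proof -
  have "{x::'a. x ^ m = x} \<subseteq> insert 0 {x. x ^ (m - 1) = 1}"
  proof
    fix x :: 'a assume "x \<in> {x. x ^ m = x}"
    moreover have "x ^ m = x * x ^ (m - 1)" using assms by (subst power_eq_if) simp
    ultimately show "x \<in> insert 0 {x. x ^ (m - 1) = 1}" by simp
  qed
  hence "card {x::'a. x ^ m = x} \<le> card (insert 0 {x::'a. x ^ (m - 1) = 1})"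
    by (intro card_mono) auto
  also have "\<dots> \<le> Suc (card {x::'a. x ^ (m - 1) = 1})" by (simp add: card_insert_if)
  also have "\<dots> \<le> Suc (m - 1)" using card_roots_power_le(2)[of "m - 1" "1::'a"] assms by simp
  finally show ?thesis using assms by simp
qed

text \<open>A term contributing to \<open>X ^ i\<close> takes \<open>X\<close> from \<open>i\<close>
  factors and a polynomial of degree at most \<open>1\<close> in \<open>t\<close> from each of the
  others. The polynomials \<open>c i\<close> are the same for all \<open>t\<close>.\<close>

lemma prod_linear_family_coeffs:
  fixes u v :: "'b::idom \<Rightarrow> 'b"
  assumes "finite S"
  shows "\<exists>c. \<forall>i. (\<forall>t. coeff (\<Prod>a\<in>S. [:- (u a - t * v a), 1:]) i = poly (c i) t) \<and>
           (if i \<le> card S then i + degree (c i) \<le> card S else c i = 0)"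
  using assms
proof (induction S)
  case empty
  show ?case by (intro exI[of _ "\<lambda>i. if i = 0 then 1 else 0"]) (auto simp: coeff_1)
next
  case (insert x S)
  then obtain c where c: "\<And>i t. coeff (\<Prod>a\<in>S. [:- (u a - t * v a), 1:]) i = poly (c i) t"
    "\<And>i. if i \<le> card S then i + degree (c i) \<le> card S else c i = 0" by blast
  define c' where "c' = (\<lambda>i. [:- u x, v x:] * c i + (if i = 0 then 0 else c (i - 1)))"
  have "coeff (\<Prod>a\<in>insert x S. [:- (u a - t * v a), 1:]) i = poly (c' i) t" for i t
  proof -
    have shift: "coeff ([:b, 1:] * f) i = b * coeff f i + (if i = 0 then 0 else coeff f (i - 1))" for b and f :: "'b poly"
      by (cases i) simp_all
    thus ?thesis unfolding prod.insert[OF insert(1,2)] shift c(1) by (simp add: c'_def c(1) algebra_simps)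
  qed
  moreover have "if i \<le> card (insert x S) then i + degree (c' i) \<le> card (insert x S) else c' i = 0" for i
  proof (cases "i \<le> Suc (card S)")
    case True
    have "degree ([:- u x, v x:] * c i) \<le> Suc (card S) - i"
    proof (cases "c i = 0")
      case False
      hence "i + degree (c i) \<le> card S" using c(2)[of i] by (auto split: if_splits)
      moreover have "degree [:- u x, v x:] \<le> 1" by simp
      ultimately show ?thesis using degree_mult_le[of "[:- u x, v x:]" "c i"] by linarith
    qed simp
    moreover have "degree (if i = 0 then 0 else c (i - 1)) \<le> Suc (card S) - i"
      using c(2)[of "i - 1"] True by (auto split: if_splits)
    ultimately have "degree (c' i) \<le> Suc (card S) - i" unfolding c'_def by (intro degree_add_le)
    thus ?thesis using True insert(1,2) by simp
  next
    case False
    hence "\<not> i \<le> card S" "\<not> i - 1 \<le> card S" by linarith+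
    hence "c i = 0" "c (i - 1) = 0" using c(2) by metis+
    thus ?thesis using False insert(1,2) by (simp add: c'_def)
  qed
  ultimately show ?case by blast
qed

lemma order_prod_linear:
  fixes \<pi> :: "'c \<Rightarrow> 'b::idom"
  assumes "finite S"
  shows "order w (\<Prod>a\<in>S. [:- \<pi> a, 1:]) = card {a \<in> S. \<pi> a = w}"
  using assms
proof (induction S)
  case empty
  thus ?case by simp
next
  case (insert x S)
  have "order w [:- \<pi> x, 1:] = (if \<pi> x = w then 1 else 0)"
    using order_power_n_n[of w 1] by (auto intro!: order_0I)
  moreover have "{a \<in> insert x S. \<pi> a = w} = (if \<pi> x = w then insert x {a \<in> S. \<pi> a = w} else {a \<in> S. \<pi> a = w})"
    by auto
  moreover have nz: "(\<Prod>a\<in>S. [:- \<pi> a, 1:]) \<noteq> 0" "[:- \<pi> x, 1:] \<noteq> 0" using insert(1) by simp_all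
  ultimately show ?case
    unfolding prod.insert[OF insert(1,2)] order_mult[OF no_zero_divisors[OF nz(2,1)]] insert(3)
    using insert(1,2) by simp
qed

lemma card_eq_sum_fibres:
  assumes "finite B" "finite T" "f ` B \<subseteq> T"
  shows "card B = (\<Sum>t\<in>T. card {x \<in> B. f x = t})"
  using sum.group[OF assms, of "\<lambda>_. 1::nat"] by simp

lemma pderiv_root_of_order_ge_2:
  fixes f :: "'b::idom poly"
  assumes "order w f \<ge> 2"
  shows "poly (pderiv f) w = 0"
proof -
  have "[:- w, 1:] ^ 2 dvd f" using assms by (simp add: order_divides)
  then obtain g where "f = [:- w, 1:] ^ 2 * g" by blast
  hence "f = [:- w, 1:] * ([:- w, 1:] * g)" by (simp only: power2_eq_square mult.assoc)
  hence "pderiv f = [:- w, 1:] * pderiv ([:- w, 1:] * g) + [:- w, 1:] * g * pderiv [:- w, 1:]"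
    by (simp only: pderiv_mult)
  thus ?thesis by simp
qed

text \<open>
  The field with \<open>q\<^sup>2\<close> elements is seen as the affine plane over its subfield of order \<open>q\<close>. The direction
  of a nonzero \<open>z\<close> is encoded as \<open>t = z\<^bsup>q - 1\<^esup>\<close>, a \<open>(q + 1)\<close>-st root of unity, and \<open>z \<mapsto> z\<^sup>q - t z\<close> is
  the projection along that direction.
\<close>

locale few_directions =
  fixes n q :: nat and A :: "'a::{field,finite} set"
  assumes n: "n \<ge> 1" and q_eq: "q = CHAR('a) ^ n" and card_K: "CARD('a) = q ^ 2"
    and p7: "CHAR('a) \<ge> 7"
    and card_A: "card A = q" and zero_A: "0 \<in> A" and one_A: "1 \<in> A"
    and few: "2 * card {(a - b) ^ (q - 1) | a b. a \<in> A \<and> b \<in> A \<and> a \<noteq> b} \<le> q + 1"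
begin

definition "directions = {(a - b) ^ (q - 1) | a b. a \<in> A \<and> b \<in> A \<and> a \<noteq> b}"
definition "unit_circle = {t::'a. t ^ (q + 1) = 1}"
definition "proj t a = a ^ q - t * (a::'a)"
text \<open>The Redei polynomial of the direction \<open>t\<close>: its root multiplicities are the
  numbers of points of \<open>A\<close> on the lines of that direction.\<close>

definition "redei t = (\<Prod>a\<in>A. [:- proj t a, 1:])"
definition "line_size t a = card {b \<in> A. proj t b = proj t a}"
abbreviation "N \<equiv> card directions"

section \<open>Directions and projections\<close>

lemma prime_p: "prime CHAR('a)" by (rule prime_CHAR_finite_field)

lemma q7: "q \<ge> 7"
  using p7 n self_le_power[of "CHAR('a)" n] by (simp add: q_eq)

lemma p_dvd_q: "CHAR('a) dvd q" using n by (simp add: q_eq dvd_power)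

lemma frob: "(x + y) ^ q = x ^ q + y ^ q" "(x - y) ^ q = x ^ q - y ^ q" for x y :: 'a
  using frobenius_add[OF prime_p q_eq] by auto

lemma pow_qq: "x ^ (q * q) = (x::'a)"
  using power_card_eq_self[of "UNIV :: 'a set" x] card_K by (simp add: power2_eq_square)

lemma q_split: "q * q = Suc ((q - 1) * (q + 1))"
  using q7 by (cases q) auto

lemma unit_circleI: "x \<noteq> 0 \<Longrightarrow> x ^ (q - 1) \<in> unit_circle"
proof -
  assume "x \<noteq> 0"
  moreover have "x * (x ^ (q - 1)) ^ (q + 1) = x"
    using pow_qq[of x] unfolding q_split power_Suc power_mult by simp
  ultimately show ?thesis unfolding unit_circle_def by simp
qed

lemma finite_directions: "finite directions" and directions_sub: "directions \<subseteq> unit_circle"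
  using unit_circleI by (auto simp: directions_def)

text \<open>The \<open>q\<^sup>2 - 1\<close> nonzero elements are sorted by direction, and at most
  \<open>q - 1\<close> of them share one.\<close>

lemma card_circle: "card unit_circle \<ge> q + 1"
proof -
  let ?B = "UNIV - {0::'a}"
  have "q * q - 1 = card ?B" using card_K by (simp add: power2_eq_square)
  also have "\<dots> = (\<Sum>t\<in>unit_circle. card {x \<in> ?B. x ^ (q - 1) = t})"
    using unit_circleI by (intro card_eq_sum_fibres) auto
  also have "\<dots> \<le> (\<Sum>t\<in>unit_circle. q - 1)"
  proof (rule sum_mono)
    fix t
    have "card {x \<in> ?B. x ^ (q - 1) = t} \<le> card {x. x ^ (q - 1) = t}"
      by (rule card_mono) auto
    also have "\<dots> \<le> q - 1" using q7 by (intro card_roots_power_le(2)) simp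
    finally show "card {x \<in> ?B. x ^ (q - 1) = t} \<le> q - 1" .
  qed
  also have "\<dots> = (q - 1) * card unit_circle" by simp
  finally have "(q - 1) * (q + 1) \<le> (q - 1) * card unit_circle" unfolding q_split diff_Suc_1 .
  thus ?thesis by (rule mult_left_le_imp_le) (use q7 in simp)
qed

lemma circle: assumes "t \<in> unit_circle" shows "t \<noteq> 0" "t * t ^ q = 1"
  using assms by (auto simp: unit_circle_def)

lemma proj_add: "proj t (a + b) = proj t a + proj t b" and proj_diff: "proj t (a - b) = proj t a - proj t b"
  by (simp_all add: proj_def frob algebra_simps)

lemma proj_eq_iff: "proj t a = proj t b \<longleftrightarrow> a = b \<or> (a - b) ^ (q - 1) = t"
proof -
  have "proj t a = proj t b \<longleftrightarrow> proj t (a - b) = 0" by (simp add: proj_diff)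
  also have "proj t z = z * (z ^ (q - 1) - t)" for z
  proof -
    have "z ^ q = z * z ^ (q - 1)" using q7 by (simp add: power_eq_if)
    thus ?thesis by (simp add: proj_def algebra_simps)
  qed
  finally show ?thesis by simp
qed

lemma proj_power: "t \<in> unit_circle \<Longrightarrow> t * proj t a ^ q + proj t a = 0"
proof -
  assume "t \<in> unit_circle"
  hence 1: "t * t ^ q = 1" by (rule circle)
  have "proj t a ^ q = a - t ^ q * a ^ q"
    using pow_qq[of a] by (simp add: proj_def frob power_mult_distrib flip: power_mult)
  moreover have "t * (a - t ^ q * x) + (x - t * a) = (1 - t * t ^ q) * x" for x
    by (simp add: algebra_simps)
  ultimately show ?thesis by (simp add: proj_def 1)
qed

section \<open>Redei polynomials\<close>

lemma redei_nz: "redei t \<noteq> 0" by (simp add: redei_def)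

lemma redei_monic: "lead_coeff (redei t) = 1"
  by (simp add: redei_def lead_coeff_prod)

lemma redei_degree: "degree (redei t) = q"
  by (simp add: redei_def degree_prod_eq_sum_degree card_A)

lemma redei_splits: "splits (redei t)" unfolding redei_def by (rule splits_prod_linear)

lemma redei_order: "order w (redei t) = card {a \<in> A. proj t a = w}"
  unfolding redei_def by (rule order_prod_linear) simp

lemma redei_root: "poly (redei t) w = 0 \<longleftrightarrow> w \<in> proj t ` A"
  by (auto simp: redei_def poly_prod)

text \<open>For \<open>t\<close> in \<open>unit_circle\<close> this is \<open>t ^ q\<close> times
  \<open>t * X ^ q + X\<close>, so it is monic and vanishes at all values of
  \<open>proj t\<close>.\<close>

definition "circle_poly t = monom 1 q + monom (t ^ q) 1"

lemma circle_poly_root: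
  assumes "t \<in> unit_circle"
  shows "poly (circle_poly t) (proj t a) = 0"
proof -
  have "t ^ q * (t * x + y) = (t * t ^ q) * x + t ^ q * y" for x y
    by (simp add: algebra_simps)
  hence "t ^ q * (t * proj t a ^ q + proj t a) = proj t a ^ q + t ^ q * proj t a"
    by (simp add: circle(2)[OF assms])
  thus ?thesis using proj_power[OF assms, of a] by (simp add: circle_poly_def poly_monom)
qed

text \<open>The \<open>q\<close> points of \<open>A\<close> project to distinct roots of
  \<open>circle_poly t\<close>, and two monic polynomials of degree \<open>q\<close> with
  \<open>q\<close> common roots agree.\<close>

lemma redei_undetermined:
  assumes "t \<in> unit_circle - directions"
  shows "redei t = circle_poly t"
proof (rule ccontr)
  assume "redei t \<noteq> circle_poly t"
  define f where "f = redei t - circle_poly t"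
  have f0: "f \<noteq> 0" using \<open>redei t \<noteq> circle_poly t\<close> by (simp add: f_def)
  have "degree f < q"
  proof (rule degree_lessI)
    show "\<forall>k\<ge>q. coeff f k = 0"
    proof (intro allI impI)
      fix k assume "k \<ge> q"
      thus "coeff f k = 0"
        using redei_monic[of t] redei_degree[of t] q7
        by (cases "k = q") (auto simp: f_def circle_poly_def coeff_monom coeff_eq_0)
    qed
  qed (use f0 in simp)
  have "inj_on (proj t) A"
    using assms by (auto simp: inj_on_def proj_eq_iff directions_def)
  hence "q = card (proj t ` A)" by (simp add: card_image card_A)
  also have "proj t ` A \<subseteq> {w. poly f w = 0}"
    using assms redei_root circle_poly_root by (auto simp: f_def)
  hence "card (proj t ` A) \<le> card {w. poly f w = 0}"
    using f0 by (intro card_mono poly_roots_finite)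
  also have "\<dots> \<le> degree f" using f0 by (rule card_poly_roots_bound)
  finally show False using \<open>degree f < q\<close> by simp
qed

lemma card_undetermined: "card (unit_circle - directions) + N \<ge> q + 1"
  using card_circle directions_sub finite_directions
  by (simp add: card_Diff_subset card_mono)

text \<open>
  The coefficient of \<open>X\<^sup>i\<close> is a polynomial in \<open>t\<close> of degree at most \<open>q - i\<close> that vanishes at every
  undetermined direction.
\<close>

lemma redei_coeff_bound:
  assumes "coeff (redei t) i \<noteq> 0" "i < q" "i \<noteq> 1"
  shows "i + 1 \<le> N"
proof -
  obtain c where c: "\<And>i t. coeff (\<Prod>a\<in>A. [:- (a ^ q - t * a), 1:]) i = poly (c i) t"
    "\<And>i. if i \<le> card A then i + degree (c i) \<le> card A else c i = 0"
    using prod_linear_family_coeffs[of A "\<lambda>a. a ^ q" "\<lambda>a. a"] by auto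
  have c': "coeff (redei t) i = poly (c i) t" for t i using c(1) by (simp add: redei_def proj_def)
  have ci: "c i \<noteq> 0" using assms(1) c' by auto
  have "unit_circle - directions \<subseteq> {t. poly (c i) t = 0}"
  proof
    fix t assume "t \<in> unit_circle - directions"
    hence "poly (c i) t = coeff (circle_poly t) i" using c' redei_undetermined by metis
    also have "\<dots> = 0" using assms by (simp add: circle_poly_def coeff_monom)
    finally show "t \<in> {t. poly (c i) t = 0}" by simp
  qed
  hence "card (unit_circle - directions) \<le> card {t. poly (c i) t = 0}"
    using ci by (intro card_mono poly_roots_finite)
  also have "\<dots> \<le> degree (c i)" using ci by (rule card_poly_roots_bound)
  finally have "card (unit_circle - directions) \<le> degree (c i)" .
  moreover have "i + degree (c i) \<le> q" using c(2)[of i] assms(2) by (simp add: card_A)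
  ultimately show ?thesis using card_undetermined by linarith
qed

text \<open>Write the polynomial as \<open>X ^ q + g\<close> with \<open>g\<close> of degree at most
  \<open>(q - 1) / 2\<close>. It divides \<open>circle_poly t\<close> times its derivative, hence
  also \<open>l * pderiv g\<close>, which has degree below \<open>q\<close> and so is
  \<open>0\<close>. If \<open>pderiv g\<close> were nonzero, the polynomial would be
  \<open>circle_poly t\<close>, which has only simple roots, while a determined direction gives a
  multiple root.\<close>

lemma pderiv_redei:
  assumes t: "t \<in> directions"
  shows "pderiv (redei t) = 0"
proof (rule ccontr)
  assume nz: "pderiv (redei t) \<noteq> 0"
  have tc: "t \<in> unit_circle" using t directions_sub by blast
  define g where "g = redei t - monom 1 q"
  define l where "l = monom (t ^ q) 1 - g"
  have deg_g: "2 * degree g \<le> q - 1"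
  proof (cases "g = 0")
    case False
    define i where "i = degree g"
    have ci: "coeff g i \<noteq> 0" using False by (simp add: i_def)
    have "i < q"
      using ci redei_monic[of t] redei_degree[of t]
      by (cases i q rule: linorder_cases) (auto simp: g_def coeff_monom coeff_eq_0)
    hence "coeff (redei t) i \<noteq> 0" using ci by (simp add: g_def coeff_monom)
    hence "i = 1 \<or> i + 1 \<le> N" using redei_coeff_bound \<open>i < q\<close> by blast
    thus ?thesis using few q7 unfolding i_def directions_def by auto
  qed simp
  hence deg_l: "2 * degree l \<le> q - 1"
    unfolding l_def using q7 degree_monom_le[of "t ^ q" 1]
      degree_diff_le[of "monom (t ^ q) 1" "(q - 1) div 2" g] by force
  have dg: "pderiv (redei t) = pderiv g"
    using p_dvd_q by (simp add: g_def pderiv_diff pderiv_monom_char)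
  have "redei t dvd circle_poly t * pderiv (redei t)"
    using redei_splits redei_nz circle_poly_root[OF tc] redei_root by (intro splits_dvd_mult_pderiv) auto
  also have "circle_poly t * pderiv (redei t) = redei t * pderiv g + l * pderiv g"
    unfolding dg by (simp add: circle_poly_def l_def g_def algebra_simps)
  finally have dvd: "redei t dvd l * pderiv g" by (simp only: dvd_add_right_iff dvd_triv_left)
  have "l * pderiv g = 0"
  proof (rule ccontr)
    assume nz': "l * pderiv g \<noteq> 0"
    hence "q \<le> degree (l * pderiv g)" using dvd dvd_imp_degree_le redei_degree by metis
    also have "\<dots> \<le> degree l + degree (pderiv g)" by (rule degree_mult_le)
    finally show False using deg_g deg_l degree_pderiv_le[of g] q7 by linarith
  qed
  hence "l = 0" using nz dg by simp
  hence "redei t = circle_poly t" by (simp add: l_def g_def circle_poly_def)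
  hence der: "pderiv (redei t) = [:t ^ q:]"
    using p_dvd_q
    by (simp add: circle_poly_def pderiv_add pderiv_monom monom_0 of_nat_eq_0_iff_char_dvd)
  obtain a b where ab: "a \<in> A" "b \<in> A" "a \<noteq> b" "t = (a - b) ^ (q - 1)"
    using t by (auto simp: directions_def)
  have "proj t a = proj t b" unfolding proj_eq_iff using ab(4) by simp
  hence "{a, b} \<subseteq> {c \<in> A. proj t c = proj t a}" using ab by auto
  hence "card {a, b} \<le> order (proj t a) (redei t)" unfolding redei_order by (intro card_mono) auto
  hence "poly (pderiv (redei t)) (proj t a) = 0" using ab(3) by (intro pderiv_root_of_order_ge_2) simp
  thus False using der circle(1)[OF tc] by simp
qed

text \<open>\<open>CHAR('a) ^ k\<close> is the largest power of the characteristic that divides the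
  sizes of all lines in direction \<open>t\<close>; \<open>1 \<le> k\<close> since the derivative
  vanishes.\<close>

lemma redei_power:
  assumes t: "t \<in> directions"
  shows "\<exists>h k. redei t = h ^ (CHAR('a) ^ k) \<and> pderiv h \<noteq> 0 \<and> lead_coeff h = 1 \<and> 1 \<le> k \<and> k \<le> n \<and>
           degree h = CHAR('a) ^ (n - k)"
proof -
  have "degree (redei t) > 0" using redei_degree q7 by simp
  then obtain h k where hk: "redei t = h ^ (CHAR('a) ^ k)" "pderiv h \<noteq> 0" using power_of_separable by blast
  have "k \<noteq> 0"
    using hk pderiv_redei[OF t] by (intro notI) simp
  have "lead_coeff h ^ (CHAR('a) ^ k) = 1 ^ (CHAR('a) ^ k)" using redei_monic[of t] by (simp add: hk(1) lead_coeff_power)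
  hence lc: "lead_coeff h = 1" unfolding frobenius_eq_iff .
  have deg: "CHAR('a) ^ n = CHAR('a) ^ k * degree h"
  proof -
    have "degree (h ^ (CHAR('a) ^ k)) = CHAR('a) ^ k * degree h"
      using hk(2) by (intro degree_power_eq) auto
    thus ?thesis using redei_degree[of t] unfolding hk(1) q_eq[symmetric] by simp
  qed
  hence "CHAR('a) ^ k dvd CHAR('a) ^ n" by simp
  hence "k \<le> n" using p7 by (auto dest: power_dvd_imp_le)
  moreover from this have "CHAR('a) ^ n = CHAR('a) ^ k * CHAR('a) ^ (n - k)" by (simp flip: power_add)
  hence "degree h = CHAR('a) ^ (n - k)" using deg p7 by simp
  ultimately show ?thesis using hk lc \<open>k \<noteq> 0\<close> by (intro exI[of _ h] exI[of _ k]) auto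
qed

section \<open>Line sizes and closure under addition\<close>

lemma line_size_redei: "line_size t a = order (proj t a) (redei t)"
  by (simp add: line_size_def redei_order)

text \<open>Every other point of \<open>A\<close> lies on one line through \<open>a\<close>, and
  \<open>a\<close> itself is counted once for each direction.\<close>

lemma sum_line_size:
  assumes a: "a \<in> A"
  shows "(\<Sum>t\<in>directions. line_size t a) = q - 1 + N"
proof -
  have eq: "line_size t a = card {b \<in> A - {a}. (b - a) ^ (q - 1) = t} + 1" for t
  proof -
    have "{b \<in> A. proj t b = proj t a} = insert a {b \<in> A - {a}. (b - a) ^ (q - 1) = t}"
      using a by (auto simp: proj_eq_iff)
    thus ?thesis by (simp add: line_size_def)
  qed
  have "(\<Sum>t\<in>directions. line_size t a) = (\<Sum>t\<in>directions. card {b \<in> A - {a}. (b - a) ^ (q - 1) = t}) + N"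
    unfolding eq sum.distrib by simp
  also have "(\<Sum>t\<in>directions. card {b \<in> A - {a}. (b - a) ^ (q - 1) = t}) = card (A - {a})"
    using a finite_directions by (intro card_eq_sum_fibres[symmetric]) (auto simp: directions_def)
  finally show ?thesis using a by (simp add: card_A)
qed

lemma undetermined_hit:
  assumes "t \<in> unit_circle - directions"
  shows "\<exists>a\<in>A. proj t a = proj t c"
proof -
  have "poly (redei t) (proj t c) = 0"
    using assms by (simp add: redei_undetermined circle_poly_root)
  thus ?thesis by (auto simp: redei_root)
qed


text \<open>The factorization \<open>h = \<Psi> * pderiv v\<close> bounds \<open>Q\<close> by the
  degree of \<open>v\<close>, and \<open>s * degree v < N\<close>; this is the first claim. If
  \<open>pderiv v\<close> is constant, the roots of \<open>h\<close> are closed under addition.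
  Otherwise its roots have multiplicity at least \<open>P\<close>, and the lines over them are long
  enough to raise the sum of line sizes from \<open>s * q\<close> to \<open>4 / 3\<close> of
  that.\<close>

lemma direction_dichotomy:
  assumes t: "t \<in> directions" and h: "redei t = h ^ (CHAR('a) ^ k)" "pderiv h \<noteq> 0" "lead_coeff h = 1"
    "1 \<le> k" "k < n" "degree h = CHAR('a) ^ (n - k)"
  defines "s \<equiv> CHAR('a) ^ k"
  assumes le: "(s - 1) * N \<le> q - 1"
  shows "q + s \<le> (s + 1) * (N - 1)"
    and "(\<forall>a\<in>A. \<forall>b\<in>A. proj t (a + b) \<in> proj t ` A) \<or> 4 * s * q \<le> 3 * (\<Sum>a\<in>A. line_size t a)"
proof -
  have tc: "t \<in> unit_circle" using t directions_sub by blast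
  define Q where "Q = CHAR('a) ^ (n - k)"
  have q: "q = s * Q" using h(5) by (simp add: q_eq s_def Q_def flip: power_add)
  have s7: "s \<ge> 7" using p7 h(4) self_le_power[of "CHAR('a)" k] by (simp add: s_def)
  have h0: "h \<noteq> 0" using h(2) by auto
  have "splits (h ^ s)" using redei_splits[of t] unfolding h(1) s_def .
  hence hsplit: "splits h" using s7 by (intro splits_power[OF h0, of s]) simp
  have hroot: "poly h w = 0 \<longleftrightarrow> w \<in> proj t ` A" for w
    using redei_root[of t w] s7 unfolding h(1) s_def[symmetric] by (simp add: poly_power)
  define v where "v = h - monom 1 Q"
  have hv: "h = monom 1 Q + v" by (simp add: v_def)
  have pQ: "CHAR('a) dvd Q" using h(5) by (simp add: Q_def dvd_power)
  have dv: "pderiv v = pderiv h" by (simp add: v_def pderiv_diff pderiv_monom_char pQ)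
  have degv0: "degree v > 0" using degree_pderiv_less[of v] dv h(2) by simp
  have degvQ: "degree v < Q"
  proof (rule degree_lessI)
    show "v \<noteq> 0 \<or> 0 < Q" using degv0 by auto
    show "\<forall>i\<ge>Q. coeff v i = 0"
      using h(3,6) by (auto simp: v_def Q_def coeff_monom coeff_eq_0)
  qed
  have Nv: "s * degree v + 1 \<le> N"
  proof (rule redei_coeff_bound)
    have "redei t = monom 1 q + v ^ s"
      unfolding h(1) hv s_def frobenius_poly unfolding s_def[symmetric] q by (simp add: monom_power mult.commute)
    moreover have "degree (v ^ s) = s * degree v" using degv0 by (intro degree_power_eq) auto
    moreover have "lead_coeff (v ^ s) \<noteq> 0" using degv0 by auto
    moreover have "s * degree v \<noteq> q" using degvQ s7 by (simp add: q)
    ultimately show "coeff (redei t) (s * degree v) \<noteq> 0" by (simp add: coeff_monom)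
    show "s * degree v < q" using degvQ s7 by (simp add: q)
    show "s * degree v \<noteq> 1" using s7 by simp
  qed
  note lac = lacunary_factorization[of k "n - k" h t, folded s_def Q_def, folded v_def]
  have prem: "1 \<le> k" "1 \<le> n - k" "5 \<le> s" "degree h = Q" "splits h" "pderiv h \<noteq> 0"
    using h s7 hsplit by (simp_all add: Q_def)
  have rt: "t * w ^ (s * Q) + w = 0" if "poly h w = 0" for w
    using that proj_power[OF tc] by (auto simp: hroot q[symmetric])
  have dg: "(s - 1) * (s * degree v + 1) \<le> s * Q - 1"
  proof -
    have "(s - 1) * (s * degree v + 1) \<le> (s - 1) * N" using Nv by (rule mult_le_mono2)
    thus ?thesis using le q by simp
  qed
  define \<Psi> where "\<Psi> = [:0, 1:] - smult t (v ^ s)"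
  have eq: "h = \<Psi> * pderiv v" and v'': "pderiv (pderiv v) = 0" and d\<Psi>: "pderiv \<Psi> = 1"
    and \<Psi>root: "\<And>w. poly h w = 0 \<Longrightarrow> poly \<Psi> w = 0"
    using lac[OF prem rt dg] by (simp_all add: \<Psi>_def)
  have \<Psi>0: "\<Psi> \<noteq> 0" using d\<Psi> by auto
  have v'0: "pderiv v \<noteq> 0" using dv h(2) by simp
  define r where "r = degree v"
  have "Q \<le> s * r + (r - 1)"
  proof -
    have "degree \<Psi> \<le> s * r"
    proof -
      have "degree (v ^ s) = s * r" using degv0 unfolding r_def by (intro degree_power_eq) auto
      moreover have "1 \<le> s * r" using degv0 s7 by (simp add: r_def)
      ultimately show ?thesis unfolding \<Psi>_def
        by (intro degree_diff_le order.trans[OF degree_smult_le]) auto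
    qed
    moreover have "degree h \<le> degree \<Psi> + degree (pderiv v)"
      unfolding eq by (rule degree_mult_le)
    ultimately show ?thesis using degree_pderiv_le[of v] prem(4) by (simp add: r_def)
  qed
  hence "Q + 1 \<le> (s + 1) * r" using degv0 by (simp add: r_def)
  hence "s * (Q + 1) \<le> s * ((s + 1) * r)" by (rule mult_le_mono2)
  also have "\<dots> = (s + 1) * (s * r)" by (simp only: mult_ac)
  also have "\<dots> \<le> (s + 1) * (N - 1)" using Nv by (intro mult_le_mono2) (simp add: r_def)
  finally show "q + s \<le> (s + 1) * (N - 1)" by (simp add: q)

  show "(\<forall>a\<in>A. \<forall>b\<in>A. proj t (a + b) \<in> proj t ` A) \<or> 4 * s * q \<le> 3 * (\<Sum>a\<in>A. line_size t a)"
  proof (cases "degree (pderiv v) = 0")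
    case True
    have "poly h 0 = 0" using zero_A hroot[of 0] q7 by (force simp: proj_def power_0_left)
    hence "poly h (x + y) = 0" if "poly h x = 0" "poly h y = 0" for x y
      using lacunary_roots_add[of k "n - k" v t x y, folded s_def Q_def, folded hv] True that eq h(4)
      by (simp add: \<Psi>_def)
    thus ?thesis by (auto simp: hroot proj_add)
  next
    case False
    obtain P where P: "\<And>w. P dvd order w (pderiv v)" "Q \<le> 3 * P * degree (pderiv v)"
      using lacunary_pderiv_multiplicities[of k t "n - k" v, folded s_def Q_def, folded hv] False h(4)
        circle(1)[OF tc] eq v'' by (auto simp: \<Psi>_def)
    define \<mu> where "\<mu> = (\<lambda>w. order w (pderiv v))"
    have oh: "order w (redei t) \<ge> s * (1 + \<mu> w)" if "w \<in> proj t ` A" for w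
    proof -
      have "order w (redei t) = s * order w h"
        unfolding h(1) s_def[symmetric] using h0 by (rule order_power_eq)
      moreover have "order w h = order w \<Psi> + \<mu> w"
        using h0 unfolding eq \<mu>_def by (rule order_mult)
      moreover have "order w \<Psi> \<ge> 1"
        using that \<Psi>root \<Psi>0 by (simp add: hroot Suc_le_eq order_gt_0_iff)
      ultimately have "1 + \<mu> w \<le> order w h" "order w (redei t) = s * order w h" by linarith+
      thus ?thesis by (simp only: mult_le_mono2)
    qed
    let ?W = "proj t ` A"
    have "s * P * degree (pderiv v) = (\<Sum>w\<in>?W. s * P * \<mu> w)"
    proof -
      have "(\<Sum>w\<in>?W. \<mu> w) = degree (pderiv v)"
        unfolding \<mu>_def
      proof (rule splits_sum_order)
        show "splits (pderiv v)" using hsplit unfolding eq splits_mult_iff[OF \<Psi>0 v'0] by simp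
        show "{w. poly (pderiv v) w = 0} \<subseteq> ?W"
        proof
          fix w assume "w \<in> {w. poly (pderiv v) w = 0}"
          hence "poly h w = 0" by (simp add: eq)
          thus "w \<in> ?W" by (simp only: hroot)
        qed
      qed (use v'0 in auto)
      thus ?thesis by (simp flip: sum_distrib_left)
    qed
    also have "\<dots> \<le> (\<Sum>w\<in>?W. card {a \<in> A. proj t a = w} * \<mu> w)"
    proof (rule sum_mono)
      fix w assume w: "w \<in> ?W"
      \<comment> \<open>A nonzero multiplicity is a multiple of \<open>P\<close>, hence at least
        \<open>P\<close>.\<close>
      have "P * \<mu> w \<le> \<mu> w * \<mu> w"
        using P(1)[of w] by (cases "\<mu> w = 0") (auto simp: \<mu>_def intro: dvd_imp_le)
      hence "s * P * \<mu> w \<le> s * \<mu> w * \<mu> w" by (simp add: mult.assoc)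
      also have "\<dots> \<le> s * (1 + \<mu> w) * \<mu> w" by simp
      also have "\<dots> \<le> order w (redei t) * \<mu> w" using oh[OF w] by (rule mult_le_mono1)
      finally show "s * P * \<mu> w \<le> card {a \<in> A. proj t a = w} * \<mu> w" by (simp add: redei_order)
    qed
    also have "\<dots> = (\<Sum>a\<in>A. \<mu> (proj t a))"
    proof -
      have "(\<Sum>a\<in>A. \<mu> (proj t a)) = (\<Sum>w\<in>?W. \<Sum>a\<in>{a \<in> A. proj t a = w}. \<mu> (proj t a))"
        by (rule sum.image_gen) simp
      also have "\<dots> = (\<Sum>w\<in>?W. card {a \<in> A. proj t a = w} * \<mu> w)" by simp
      finally show ?thesis ..
    qed
    finally have 1: "s * P * degree (pderiv v) \<le> (\<Sum>a\<in>A. \<mu> (proj t a))" .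
    have "(\<Sum>a\<in>A. s * (1 + \<mu> (proj t a))) \<le> (\<Sum>a\<in>A. line_size t a)"
      using oh by (intro sum_mono) (simp add: line_size_redei)
    also have "(\<Sum>a\<in>A. s * (1 + \<mu> (proj t a))) = s * q + s * (\<Sum>a\<in>A. \<mu> (proj t a))"
      by (simp add: sum.distrib card_A distrib_left flip: sum_distrib_left)
    finally have 2: "s * q + s * (\<Sum>a\<in>A. \<mu> (proj t a)) \<le> (\<Sum>a\<in>A. line_size t a)" .
    have "q \<le> s * (3 * P * degree (pderiv v))" unfolding q using P(2) by (rule mult_le_mono2)
    also have "\<dots> = 3 * (s * P * degree (pderiv v))" by simp
    also have "\<dots> \<le> 3 * (\<Sum>a\<in>A. \<mu> (proj t a))" using 1 by (rule mult_le_mono2)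
    finally have "s * q \<le> s * (3 * (\<Sum>a\<in>A. \<mu> (proj t a)))" by (rule mult_le_mono2)
    hence "4 * s * q \<le> 3 * (s * q + s * (\<Sum>a\<in>A. \<mu> (proj t a)))" by (simp add: algebra_simps)
    also have "\<dots> \<le> 3 * (\<Sum>a\<in>A. line_size t a)" using 2 by (rule mult_le_mono2)
    finally show ?thesis ..
  qed
qed

text \<open>If \<open>c = a + b\<close> is not in \<open>A\<close>, count the points of
  \<open>A\<close> by their direction from \<open>c\<close>: at least one in each undetermined
  direction and at least \<open>s\<close> in each direction of \<open>G\<close>. So \<open>G\<close>
  is small, the second moment count makes its complement small, and \<open>N\<close> falls below its
  lower bound.\<close>

lemma add_closed:
  assumes ab: "a \<in> A" "b \<in> A"
  shows "a + b \<in> A"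
proof -
  define Z where "Z = (\<lambda>t h k. redei t = h ^ (CHAR('a) ^ k) \<and> pderiv h \<noteq> 0 \<and> lead_coeff h = 1 \<and>
      1 \<le> k \<and> k \<le> n \<and> degree h = CHAR('a) ^ (n - k))"
  have "\<forall>t\<in>directions. \<exists>x. Z t (fst x) (snd x)"
    using redei_power by (simp add: Z_def)
  then obtain x where "\<forall>t\<in>directions. Z t (fst (x t)) (snd (x t))" by (rule bchoice[THEN exE])
  moreover define h k where "h = fst \<circ> x" and "k = snd \<circ> x"
  ultimately have Z: "Z t (h t) (k t)" if "t \<in> directions" for t using that by simp
  hence hk: "\<And>t. t \<in> directions \<Longrightarrow> redei t = h t ^ (CHAR('a) ^ k t)"
      "\<And>t. t \<in> directions \<Longrightarrow> pderiv (h t) \<noteq> 0" "\<And>t. t \<in> directions \<Longrightarrow> lead_coeff (h t) = 1"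
      "\<And>t. t \<in> directions \<Longrightarrow> 1 \<le> k t" "\<And>t. t \<in> directions \<Longrightarrow> k t \<le> n"
      "\<And>t. t \<in> directions \<Longrightarrow> degree (h t) = CHAR('a) ^ (n - k t)"
    unfolding Z_def by blast+
  have one_dir: "1 \<in> directions"
    unfolding directions_def using zero_A one_A by (intro CollectI exI[of _ 1] exI[of _ 0]) simp
  define k0 where "k0 = Min (k ` directions)"
  have "k0 \<in> k ` directions" unfolding k0_def using one_dir finite_directions by (intro Min_in) auto
  then obtain t0 where t0: "t0 \<in> directions" "k t0 = k0" by auto
  have k0: "k0 \<le> k t" if "t \<in> directions" for t
    unfolding k0_def using that finite_directions by simp
  define s where "s = CHAR('a) ^ k0"
  have s7: "s \<ge> 7" using p7 hk(4)[OF t0(1)] t0(2) self_le_power[of "CHAR('a)" k0] by (simp add: s_def)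
  have size_ge: "CHAR('a) ^ k t \<le> line_size t x" if t: "t \<in> directions" and x: "x \<in> A" for t x
  proof -
    have h0: "h t \<noteq> 0" using hk(2)[OF t] by auto
    have "poly (redei t) (proj t x) = 0" using x by (simp add: redei_root)
    hence "order (proj t x) (h t) > 0"
      unfolding hk(1)[OF t] using h0 by (simp add: poly_power order_gt_0_iff)
    moreover have "line_size t x = CHAR('a) ^ k t * order (proj t x) (h t)"
      unfolding line_size_redei hk(1)[OF t] using h0 by (rule order_power_eq)
    ultimately show ?thesis by simp
  qed
  have s_le: "s \<le> line_size t x" if "t \<in> directions" "x \<in> A" for t x
  proof -
    have "CHAR('a) ^ k0 \<le> CHAR('a) ^ k t" using k0[OF that(1)] p7 by (intro power_increasing) auto
    thus ?thesis using size_ge[OF that] by (simp add: s_def)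
  qed
  \<comment> \<open>Counting along the lines through \<open>0\<close> gives the bound on
    \<open>s\<close> that \<open>direction_dichotomy\<close> assumes.\<close>
  have "N * s = (\<Sum>t\<in>directions. s)" by simp
  also have "\<dots> \<le> (\<Sum>t\<in>directions. line_size t 0)" using s_le zero_A by (intro sum_mono) auto
  also have "\<dots> = q - 1 + N" by (rule sum_line_size[OF zero_A])
  finally have "N * s \<le> q - 1 + N" .
  moreover have "(s - 1) * N + N = N * s" using s7 by (cases s) simp_all
  ultimately have Ns: "(s - 1) * N \<le> q - 1" by linarith
  show ?thesis
  proof (cases "k0 = n")
    case True
    \<comment> \<open>Here \<open>s = q\<close>, so \<open>A\<close> lies on the line through
      \<open>0\<close> in direction \<open>1\<close>, which consists of the fixed points of
      \<open>x \<mapsto> x ^ q\<close>.\<close>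
    have eqA: "{b \<in> A. proj 1 b = proj 1 0} = A"
    proof (rule card_seteq)
      have "s = q" unfolding s_def True q_eq ..
      thus "card A \<le> card {b \<in> A. proj 1 b = proj 1 0}"
        using s_le[OF one_dir zero_A] by (simp add: card_A line_size_def)
    qed auto
    have sub: "A \<subseteq> {x. x ^ q = x}"
    proof
      fix x assume "x \<in> A"
      hence "x \<in> {b \<in> A. proj 1 b = proj 1 0}" by (simp only: eqA)
      thus "x \<in> {x. x ^ q = x}" using q7 by (simp add: proj_def power_0_left)
    qed
    have card_le: "card {x::'a. x ^ q = x} \<le> q" using q7 by (intro card_fixed_power_le) simp
    have "A = {x. x ^ q = x}" using sub card_le card_A by (intro card_seteq) auto
    thus ?thesis using ab by (simp add: frob)
  next
    case False
    hence k0n: "k0 < n" using hk(5)[OF t0(1)] t0(2) by simp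
    define G where "G = {t \<in> directions. \<forall>a\<in>A. \<forall>b\<in>A. proj t (a + b) \<in> proj t ` A}"
    have fG: "finite G" "G \<subseteq> directions" using finite_directions by (auto simp: G_def)
    have Nlow: "q + s \<le> (s + 1) * (N - 1)"
      using direction_dichotomy(1)[OF t0(1) hk(1-4)[OF t0(1)] _ hk(6)[OF t0(1)]] t0(2) k0n Ns
      by (simp add: s_def)
    \<comment> \<open>Either \<open>k t = k0\<close> and the dichotomy applies, or every line in
      this direction that meets \<open>A\<close> has at least \<open>2 * s\<close> points of
      it.\<close>
    have bad: "4 * s * q \<le> 3 * (\<Sum>a\<in>A. line_size t a)" if t: "t \<in> directions - G" for t
    proof (cases "k t = k0")
      case True
      thus ?thesis
        using direction_dichotomy(2)[OF _ hk(1-4)[of t] _ hk(6)[of t]] t k0n Ns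
        by (auto simp: s_def G_def)
    next
      case False
      hence "Suc k0 \<le> k t" using k0[of t] t by simp
      hence "CHAR('a) ^ Suc k0 \<le> CHAR('a) ^ k t" using p7 by (intro power_increasing) auto
      moreover have "2 * s \<le> CHAR('a) ^ Suc k0" using p7 by (simp add: s_def)
      ultimately have "2 * s \<le> line_size t x" if "x \<in> A" for x
        using size_ge[of t x] that t by simp
      hence "(\<Sum>a\<in>A. 2 * s) \<le> (\<Sum>a\<in>A. line_size t a)" by (rule sum_mono)
      thus ?thesis by (simp add: card_A mult_ac)
    qed
    have good: "s * q \<le> (\<Sum>a\<in>A. line_size t a)" if "t \<in> G" for t
    proof -
      have "(\<Sum>a\<in>A. s) \<le> (\<Sum>a\<in>A. line_size t a)" using s_le fG(2) that by (intro sum_mono) auto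
      thus ?thesis by (simp add: card_A mult.commute)
    qed
    have total: "(\<Sum>t\<in>directions. \<Sum>a\<in>A. line_size t a) = q * (q - 1 + N)"
      using sum_line_size by (subst sum.swap) (simp add: card_A)
    have NG: "N = card (directions - G) + card G"
      using fG finite_directions by (simp add: card_Diff_subset card_mono)
    have "4 * s * q * card (directions - G) + 3 * (s * q * card G) \<le>
        (\<Sum>t\<in>directions - G. 3 * (\<Sum>a\<in>A. line_size t a)) + 3 * (\<Sum>t\<in>G. \<Sum>a\<in>A. line_size t a)"
      using sum_mono[of "directions - G" "\<lambda>_. 4 * s * q" "\<lambda>t. 3 * (\<Sum>a\<in>A. line_size t a)"] bad
        sum_mono[of G "\<lambda>_. s * q" "\<lambda>t. \<Sum>a\<in>A. line_size t a"] good
      by (simp add: mult_ac)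
    also have "\<dots> = 3 * (q * (q - 1 + N))"
      unfolding total[symmetric] using sum.subset_diff[OF fG(2) finite_directions, of "\<lambda>t. \<Sum>a\<in>A. line_size t a"]
      by (simp add: distrib_left flip: sum_distrib_left)
    finally have "q * (4 * s * card (directions - G) + 3 * s * card G) \<le> q * (3 * (q - 1 + N))"
      by (simp add: algebra_simps)
    hence up: "4 * s * card (directions - G) + 3 * s * card G \<le> 3 * (q - 1 + N)"
      using q7 by (rule_tac mult_left_le_imp_le[of q]) auto
    show ?thesis
    proof (rule ccontr)
      assume c: "a + b \<notin> A"
      define c where "c = a + b"
      have cA: "c \<notin> A" using c by (simp add: c_def)
      \<comment> \<open>As \<open>c\<close> is not in \<open>A\<close>, every point of
        \<open>A\<close> is seen from \<open>c\<close> in exactly one direction.\<close>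
      have fib: "{x \<in> A. (c - x) ^ (q - 1) = t} = {x \<in> A. proj t x = proj t c}" for t
      proof -
        have "(c - x) ^ (q - 1) = t \<longleftrightarrow> proj t x = proj t c" if "x \<in> A" for x
          using proj_eq_iff[of t c x] that cA by auto
        thus ?thesis by auto
      qed
      have "card A = (\<Sum>t\<in>unit_circle. card {x \<in> A. (c - x) ^ (q - 1) = t})"
      proof (rule card_eq_sum_fibres)
        show "(\<lambda>x. (c - x) ^ (q - 1)) ` A \<subseteq> unit_circle"
          using cA by (intro image_subsetI unit_circleI) auto
      qed auto
      hence "q = (\<Sum>t\<in>unit_circle. card {x \<in> A. proj t x = proj t c})"
        unfolding fib card_A .
      also have "\<dots> \<ge> (\<Sum>t\<in>(unit_circle - directions) \<union> G. card {x \<in> A. proj t x = proj t c})"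
        using fG directions_sub by (intro sum_mono2) auto
      also have "(\<Sum>t\<in>(unit_circle - directions) \<union> G. card {x \<in> A. proj t x = proj t c}) =
          (\<Sum>t\<in>unit_circle - directions. card {x \<in> A. proj t x = proj t c}) + (\<Sum>t\<in>G. card {x \<in> A. proj t x = proj t c})"
        using fG by (intro sum.union_disjoint) auto
      finally have "(\<Sum>t\<in>unit_circle - directions. card {x \<in> A. proj t x = proj t c}) +
          (\<Sum>t\<in>G. card {x \<in> A. proj t x = proj t c}) \<le> q" .
      moreover have "(\<Sum>t\<in>unit_circle - directions. 1) \<le> (\<Sum>t\<in>unit_circle - directions. card {x \<in> A. proj t x = proj t c})"
      proof (rule sum_mono)
        fix t assume "t \<in> unit_circle - directions"
        from undetermined_hit[OF this, of c] show "1 \<le> card {x \<in> A. proj t x = proj t c}"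
          by (auto simp: Suc_le_eq card_gt_0_iff)
      qed
      moreover have "(\<Sum>t\<in>G. s) \<le> (\<Sum>t\<in>G. card {x \<in> A. proj t x = proj t c})"
      proof (rule sum_mono)
        fix t assume t: "t \<in> G"
        hence "proj t c \<in> proj t ` A" using ab by (simp add: G_def c_def)
        then obtain x where "x \<in> A" "proj t x = proj t c" by (metis imageE)
        thus "s \<le> card {x \<in> A. proj t x = proj t c}"
          using s_le[of t x] t fG(2) by (auto simp: line_size_def)
      qed
      ultimately have "card (unit_circle - directions) + s * card G \<le> q" by (simp add: mult.commute)
      hence sG: "s * card G + 1 \<le> N" using card_undetermined by linarith
      \<comment> \<open>With names for the products the rest is linear:
        \<open>4 * z < 3 * q + 4 * N\<close>, \<open>q + 2 * s \<le> z + N\<close> and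
        \<open>7 * N \<le> z\<close> are incompatible. The last one uses
        \<open>s \<ge> 7\<close>.\<close>
      define u w z where "u = s * card (directions - G)" and "w = s * card G" and "z = s * N"
      have "z = u + w" unfolding z_def u_def w_def NG by (simp add: distrib_left)
      moreover have "4 * u + 3 * w + 3 \<le> 3 * q + 3 * N"
        using up q7 by (simp add: u_def w_def mult.assoc)
      moreover have "w + 1 \<le> N" using sG by (simp add: w_def)
      ultimately have "4 * z + 1 \<le> 3 * q + 4 * N" by linarith
      moreover have "q + 2 * s \<le> z + N"
      proof -
        have "(s + 1) * (N - 1) + (s + 1) = z + N"
          using sG by (cases N) (auto simp: z_def)
        thus ?thesis using Nlow by linarith
      qed
      moreover have "7 * N \<le> z" unfolding z_def using s7 by (rule mult_le_mono1)
      ultimately show False using s7 by linarith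
    qed
  qed
qed

end

section \<open>Additive subgroups and cosets\<close>

text \<open>Every element satisfies \<open>x ^ q = x\<close>, an equation with at most
  \<open>q\<close> solutions.\<close>

lemma mult_closed_eq_fixed_points:
  fixes L :: "'a::{field,finite} set"
  assumes "0 \<in> L" "\<And>x y. x \<in> L \<Longrightarrow> y \<in> L \<Longrightarrow> x * y \<in> L" "card L = q" "q \<ge> 2"
  shows "L = {x. x ^ q = x}"
proof (rule card_seteq)
  show "L \<subseteq> {x. x ^ q = x}" using power_card_eq_self[of L] assms by auto
  show "card {x::'a. x ^ q = x} \<le> card L" using card_fixed_power_le[OF assms(4)] assms(3) by simp
qed auto

lemma of_nat_frobenius_fixed:
  fixes y :: nat
  shows "(of_nat y :: 'a::{field,finite}) ^ (CHAR('a) ^ j) = of_nat y"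
  using prime_gt_0_nat[OF prime_CHAR_finite_field[where 'a='a]]
  by (induction y) (simp_all add: power_0_left frobenius_add[OF prime_CHAR_finite_field refl])

text \<open>
  An additive subgroup of order \<open>q\<close> other than the subfield of order \<open>q\<close> meets every proper subfield
  in a proper subgroup, and these subgroups are too few to cover it.
\<close>

lemma exists_primitive_element:
  fixes A :: "'a::{field,finite} set"
  assumes card_K: "CARD('a) = q ^ 2" and q: "q = CHAR('a) ^ n" "n \<ge> 1" and p: "CHAR('a) \<ge> 2 * n"
    and A: "0 \<in> A" "\<And>x y. x \<in> A \<Longrightarrow> y \<in> A \<Longrightarrow> x + y \<in> A" "card A = q" "A \<noteq> {x. x ^ q = x}"
  shows "\<exists>\<theta>\<in>A. \<forall>j. 0 < j \<longrightarrow> j < 2 * n \<longrightarrow> \<theta> ^ (CHAR('a) ^ j) \<noteq> \<theta>"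
proof (rule ccontr)
  let ?p = "CHAR('a)"
  have prime: "prime ?p" by (rule prime_CHAR_finite_field)
  have p2: "?p \<ge> 2" using prime by (rule prime_ge_2_nat)
  have q2: "q \<ge> 2" using p2 q self_le_power[of ?p n] by simp
  define L where "L = (\<lambda>j. {x::'a. x ^ (?p ^ j) = x})"
  assume "\<not> (\<exists>\<theta>\<in>A. \<forall>j. 0 < j \<longrightarrow> j < 2 * n \<longrightarrow> \<theta> ^ (?p ^ j) \<noteq> \<theta>)"
  hence cover: "A \<subseteq> (\<Union>j\<in>{0<..<2 * n}. A \<inter> L j)" by (fastforce simp: L_def)
  have frob: "(x + y) ^ (?p ^ j) = x ^ (?p ^ j) + y ^ (?p ^ j)" "(x - y) ^ (?p ^ j) = x ^ (?p ^ j) - y ^ (?p ^ j)"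
    for x y :: 'a and j using frobenius_add[OF prime refl] by auto
  have small: "?p * card (A \<inter> L j) \<le> q" if j: "j \<in> {0<..<2 * n}" for j
  proof -
    \<comment> \<open>\<open>L j\<close> is a proper subfield. For \<omega> outside it,
      \<open>1\<close> and \<omega> are independent over \<open>L j\<close>, so
      \<open>card (L j) ^ 2 \<le> q ^ 2\<close>.\<close>
    have card_L: "card (L j) \<le> q"
    proof -
      have "card (L j) \<le> ?p ^ j"
        unfolding L_def using p2 j self_le_power[of ?p j] by (intro card_fixed_power_le) simp
      also have "\<dots> < ?p ^ (2 * n)" using p2 j by (intro power_strict_increasing) auto
      also have "\<dots> = CARD('a)" by (simp add: card_K q mult.commute flip: power_mult)
      finally obtain \<omega> where \<omega>: "\<omega> \<notin> L j" by (metis UNIV_eq_I less_irrefl)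
      have "inj_on (\<lambda>(a, b). a + b * \<omega>) (L j \<times> L j)"
      proof (rule inj_onI, clarify)
        fix a b a' b' assume ab: "a \<in> L j" "b \<in> L j" "a' \<in> L j" "b' \<in> L j" "a + b * \<omega> = a' + b' * \<omega>"
        have "b = b'"
        proof (rule ccontr)
          assume ne: "b \<noteq> b'"
          have "\<omega> * (b - b') = a' - a" using ab(5) by (simp add: algebra_simps)
          hence "\<omega> = (a' - a) / (b - b')" using ne by (simp add: field_simps)
          moreover have "(a' - a) / (b - b') \<in> L j"
            using ab by (simp add: L_def power_divide frob)
          ultimately show False using \<omega> by simp
        qed
        thus "a = a' \<and> b = b'" using ab(5) by simp
      qed
      hence "card (L j \<times> L j) \<le> CARD('a)" by (intro card_inj_on_le[of _ _ UNIV]) auto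
      hence "card (L j) ^ 2 \<le> q ^ 2" by (simp add: card_K power2_eq_square card_cartesian_product)
      thus ?thesis by (rule power2_le_imp_le) simp
    qed
    have "\<not> A \<subseteq> L j"
    proof
      assume "A \<subseteq> L j"
      hence "A = L j" using card_L A(3) by (intro card_seteq) auto
      moreover have "L j = {x. x ^ q = x}"
      proof (rule mult_closed_eq_fixed_points)
        show "card (L j) = q" using \<open>A = L j\<close> A(3) by simp
      qed (use q2 p2 in \<open>auto simp: L_def power_mult_distrib power_0_left\<close>)
      ultimately show False using A(4) by simp
    qed
    then obtain a where a: "a \<in> A" "a \<notin> L j" by blast
    \<comment> \<open>The map \<open>x \<mapsto> x ^ (?p ^ j) - x\<close> sends
      \<open>i * a + b\<close> to \<open>i * \<delta>\<close> for \<open>b\<close> in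
      \<open>L j\<close>. So \<open>?p\<close> disjoint translates of \<open>A \<inter> L j\<close>
      fit into \<open>A\<close>.\<close>
    define \<delta> where "\<delta> = a ^ (?p ^ j) - a"
    have \<delta>0: "\<delta> \<noteq> 0" using a(2) by (simp add: \<delta>_def L_def)
    define f where "f = (\<lambda>(i::nat, b::'a). of_nat i * a + b)"
    have "inj_on f ({..<?p} \<times> (A \<inter> L j))"
    proof (rule inj_onI)
      fix x y assume xy: "x \<in> {..<?p} \<times> (A \<inter> L j)" "y \<in> {..<?p} \<times> (A \<inter> L j)" "f x = f y"
      obtain i b i' b' where x: "x = (i, b)" and y: "y = (i', b')" by (metis surj_pair)
      have ib: "i < ?p" "b \<in> L j" "i' < ?p" "b' \<in> L j" "f (i, b) = f (i', b')"
        using xy by (auto simp: x y)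
      have key: "f (i, b) ^ (?p ^ j) - f (i, b) = of_nat i * \<delta>" if "b \<in> L j" for i b
        using that by (simp add: f_def frob power_mult_distrib of_nat_frobenius_fixed L_def \<delta>_def algebra_simps)
      have "of_nat i * \<delta> = of_nat i' * \<delta>" using key[of b i] key[of b' i'] ib by metis
      hence "(of_nat i :: 'a) = of_nat i'" using \<delta>0 by simp
      hence "i = i'" using ib(1,3) by (simp add: of_nat_eq_iff_cong_CHAR cong_def)
      thus "x = y" using ib(5) by (simp add: f_def x y)
    qed
    moreover have "f ` ({..<?p} \<times> (A \<inter> L j)) \<subseteq> A"
    proof -
      have "of_nat i * a \<in> A" for i using A(1,2) a(1) by (induction i) (simp_all add: distrib_right)
      thus ?thesis using A(2) by (auto simp: f_def)
    qed
    ultimately have "card ({..<?p} \<times> (A \<inter> L j)) \<le> card A" by (intro card_inj_on_le) auto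
    thus ?thesis by (simp add: card_cartesian_product A(3))
  qed
  have "q \<le> card (\<Union>j\<in>{0<..<2 * n}. A \<inter> L j)" unfolding A(3)[symmetric] using cover by (intro card_mono) auto
  also have "\<dots> \<le> (\<Sum>j\<in>{0<..<2 * n}. card (A \<inter> L j))" by (rule card_UN_le) simp
  finally have "?p * q \<le> ?p * (\<Sum>j\<in>{0<..<2 * n}. card (A \<inter> L j))" by (rule mult_le_mono2)
  also have "\<dots> = (\<Sum>j\<in>{0<..<2 * n}. ?p * card (A \<inter> L j))" by (rule sum_distrib_left)
  also have "\<dots> \<le> (\<Sum>j\<in>{0<..<2 * n}. q)" using small by (rule sum_mono)
  also have "\<dots> = (2 * n - 1) * q" by simp
  finally show False using p q(2) q2 by simp
qed

section \<open>Subfields, cosets and the proof of the theorem\<close>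

lemma subfield_of_type_eq_fixed_points:
  fixes F :: "'a::{field,finite} set"
  assumes "subfield F ring_of_type_algebra" "card F = q" "q \<ge> 2"
  shows "F = {x. x ^ q = x}"
proof (rule mult_closed_eq_fixed_points)
  have "subring F ring_of_type_algebra"
    using assms(1) by (simp add: subfield_def subdomain_def subcring_def)
  from subringE(2)[OF this] subringE(6)[OF this]
  show "0 \<in> F" "\<And>x y. x \<in> F \<Longrightarrow> y \<in> F \<Longrightarrow> x * y \<in> F"
    by (simp_all add: ring_of_type_algebra_def)
qed (use assms in auto)

text \<open>\<open>x \<mapsto> x ^ card H\<close> is \<open>1\<close> on \<open>H\<close>, hence
  constant on each coset. The index formula is the theorem of Lagrange.\<close>

lemma coset_union_powers:
  fixes H S :: "'a::{field,finite} set"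
  assumes H: "subgroup H field_units"
    and C: "C \<subseteq> rcosets\<^bsub>field_units\<^esub> H"
  shows "card {x ^ card H | x. x \<in> \<Union>C} \<le> card C"
    and "card H * card (rcosets\<^bsub>field_units\<^esub> H) = CARD('a) - 1"
proof -
  interpret group "field_units :: 'a monoid"
    using Multiplicative_Group.field.field_mult_group[OF field_from_type_algebra] .
  have carrier: "carrier (field_units :: 'a monoid) = UNIV - {0}"
    by (simp add: ring_of_type_algebra_def)
  have mult: "x \<otimes>\<^bsub>field_units\<^esub> y = x * y" for x y :: 'a
    by (simp add: ring_of_type_algebra_def)
  have "card (rcosets\<^bsub>field_units\<^esub> H) * card H = Coset.order (field_units :: 'a monoid)"
    using H by (rule lagrange)
  thus "card H * card (rcosets\<^bsub>field_units\<^esub> H) = CARD('a) - 1"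
    unfolding Coset.order_def carrier by (simp add: mult.commute)
  have Hsub: "H \<subseteq> UNIV - {0}" using subgroup.subset[OF H] carrier by simp
  have H1: "x ^ card H = 1" if x: "x \<in> H" for x
  proof -
    have "x ^ card (insert 0 H) = x"
    proof (rule power_card_eq_self)
      show "y * z \<in> insert 0 H" if "y \<in> insert 0 H" "z \<in> insert 0 H" for y z
        using that subgroup.m_closed[OF H, of y z] unfolding mult by auto
    qed (use x in auto)
    moreover have "card (insert 0 H) = Suc (card H)" using Hsub by (subst card_insert_disjoint) auto
    ultimately show ?thesis using x Hsub by auto
  qed
  define f where "f = (\<lambda>c :: 'a set. (SOME x. x \<in> c) ^ card H)"
  have "{x ^ card H | x. x \<in> \<Union>C} \<subseteq> f ` C"
  proof clarify
    fix x c assume xc: "x \<in> c" "c \<in> C"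
    then obtain z where z: "c = H #>\<^bsub>field_units\<^esub> z" using C by (auto simp: RCOSETS_def)
    have "y ^ card H = z ^ card H" if "y \<in> c" for y
      using that unfolding z r_coset_def mult by (auto simp: power_mult_distrib H1)
    moreover have "(SOME x. x \<in> c) \<in> c" using xc(1) by (rule someI)
    ultimately have "x ^ card H = f c" using xc(1) by (simp add: f_def)
    thus "x ^ card H \<in> f ` C" using xc(2) by blast
  qed
  thus "card {x ^ card H | x. x \<in> \<Union>C} \<le> card C"
    by (meson card_image_le card_mono finite finite_imageI le_trans)
qed

theorem corollary1p9:
  fixes n d p q :: nat
    and F H S A :: "'a::{field, finite} set"
    and C :: "'a set set"
  assumes "n \<ge> 2" and "d \<ge> 2"
    and "prime p" and "q = p ^ n"
    and "[int q = - 1] (mod int d)"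
    and "p \<ge> 2 * (4 * n - 1)\<^sup>2 * d"
    and "CARD('a) = q\<^sup>2"
    and "subfield F ring_of_type_algebra" and "card F = q"
    and "subgroup H field_units" and "card (rcosets\<^bsub>field_units\<^esub> H) = d"
    and "C \<subseteq> rcosets\<^bsub>field_units\<^esub> H" and "real (card C) \<le> real d / 2"
    and "S = \<Union>C"
    and "F - {0} \<subseteq> S"
    and "0 \<in> A" and "1 \<in> A" and "card A = q"
    and "{a - b | a b. a \<in> A \<and> b \<in> A} \<subseteq> S \<union> {0}"
  shows "A = F"
proof -
  note n = assms(1) and d = assms(2) and p_ge = assms(6)
  have "CHAR('a) dvd p ^ (n * 2)"
    using CHAR_dvd_CARD[where 'a='a] assms(4,7) by (simp add: power_mult)
  hence char: "CHAR('a) = p"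
    using assms(3) prime_CHAR_finite_field[where 'a='a] prime_dvd_power primes_dvd_imp_eq by blast
  have p_big: "p \<ge> 196" "p \<ge> 2 * n"
  proof -
    have 7: "4 * n - 1 \<ge> 7" using n by simp
    have "2 * 7\<^sup>2 * 2 \<le> 2 * (4 * n - 1)\<^sup>2 * d"
      using 7 d by (intro mult_le_mono power_mono) auto
    moreover have "2 * 7\<^sup>2 * 2 = (196 :: nat)" by simp
    ultimately show "p \<ge> 196" using p_ge by linarith
    have "2 * n \<le> (4 * n - 1) * 1" using n by simp
    also have "\<dots> \<le> (4 * n - 1) * (4 * n - 1)" using 7 by (intro mult_le_mono2) simp
    also have "\<dots> \<le> 2 * (4 * n - 1)\<^sup>2 * d" using d by (simp add: power2_eq_square)
    finally show "p \<ge> 2 * n" using p_ge by linarith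
  qed
  have q2: "q \<ge> 2" using p_big n self_le_power[of p n] assms(4) by simp
  define E where "E = card H"
  define \<Omega> where "\<Omega> = {x ^ E | x. x \<in> S}"
  have S\<Omega>: "x ^ E \<in> \<Omega>" if "x \<in> S" for x using that by (auto simp: \<Omega>_def)
  have \<Omega>: "2 * card \<Omega> \<le> d"
  proof -
    have "card \<Omega> \<le> card C" using coset_union_powers(1)[OF assms(10,12)] by (simp add: \<Omega>_def E_def assms(14))
    moreover have "2 * card C \<le> d" using assms(13) by linarith
    ultimately show ?thesis by linarith
  qed
  have Ed: "E * d = q\<^sup>2 - 1"
    using coset_union_powers(2)[OF assms(10,12)] by (simp add: E_def assms(7,11))
  have "int d dvd int q + 1" using assms(5) by (simp add: cong_iff_dvd_diff)
  hence "int d dvd int (q + 1)" by (simp add: add.commute)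
  hence "d dvd q + 1" by (simp only: int_dvd_int_iff)
  then obtain e where e: "q + 1 = d * e" by blast
  have e0: "e > 0" using e by (cases e) auto
  \<comment> \<open>Thus \<open>x ^ E\<close> is the \<open>e\<close>-th power of the direction
    \<open>x ^ (q - 1)\<close>, with \<open>e = (q + 1) / d\<close>.\<close>
  have E: "E = (q - 1) * e"
  proof -
    have "E * d = (q - 1) * (q + 1)" using Ed q2 by (cases q) (auto simp: power2_eq_square)
    also have "\<dots> = ((q - 1) * e) * d" unfolding e by (simp only: mult_ac)
    finally show ?thesis using d by simp
  qed
  have diff: "(a - b) ^ E \<in> \<Omega>" if "a \<in> A" "b \<in> A" "a \<noteq> b" for a b
  proof (rule S\<Omega>)
    have "a - b \<in> S \<union> {0}" using that(1,2) by (intro subsetD[OF assms(19)]) blast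
    thus "a - b \<in> S" using that(3) by simp
  qed
  \<comment> \<open>Each of the at most \<open>d / 2\<close> values in \<Omega> comes from at most
    \<open>e\<close> directions, and \<open>d * e = q + 1\<close>.\<close>
  have "{(a - b) ^ (q - 1) | a b. a \<in> A \<and> b \<in> A \<and> a \<noteq> b} \<subseteq> (\<Union>\<omega>\<in>\<Omega>. {t. t ^ e = \<omega>})"
    using diff by (auto simp: E power_mult)
  hence "card {(a - b) ^ (q - 1) | a b. a \<in> A \<and> b \<in> A \<and> a \<noteq> b} \<le> card (\<Union>\<omega>\<in>\<Omega>. {t. t ^ e = \<omega>})"
    by (intro card_mono) auto
  also have "\<dots> \<le> (\<Sum>\<omega>\<in>\<Omega>. card {t. t ^ e = \<omega>})" by (rule card_UN_le) simp
  also have "\<dots> \<le> (\<Sum>\<omega>\<in>\<Omega>. e)" using card_roots_power_le(2)[OF e0] by (rule sum_mono)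
  finally have "2 * card {(a - b) ^ (q - 1) | a b. a \<in> A \<and> b \<in> A \<and> a \<noteq> b} \<le> 2 * card \<Omega> * e" by simp
  also have "\<dots> \<le> d * e" using \<Omega> by (rule mult_le_mono1)
  finally have few: "2 * card {(a - b) ^ (q - 1) | a b. a \<in> A \<and> b \<in> A \<and> a \<noteq> b} \<le> q + 1" by (simp only: e)
  interpret plane: few_directions n q A
    by unfold_locales (use assms few n p_big char in auto)
  show ?thesis
  proof (rule ccontr)
    assume "A \<noteq> F"
    hence "A \<noteq> {x. x ^ q = x}"
      using subfield_of_type_eq_fixed_points[OF assms(8,9) q2] by simp
    then obtain \<theta> where \<theta>: "\<theta> \<in> A" "\<And>j. 0 < j \<Longrightarrow> j < 2 * n \<Longrightarrow> \<theta> ^ (CHAR('a) ^ j) \<noteq> \<theta>"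
      using exists_primitive_element[of q n A] assms(4,7,16,18) plane.add_closed n p_big char by auto
    show False
    \<comment> \<open>Applied with \<open>k = 2 * n\<close>, for which
      \<open>p ^ k = q\<^sup>2\<close> and \<open>2 * k - 1 = 4 * n - 1\<close>.\<close>
    proof (rule not_all_shifts_in_half_of_cosets)
      show "2 * n \<ge> 4" using n by simp
      show "E * d = CHAR('a) ^ (2 * n) - 1"
        unfolding Ed char assms(4) by (simp add: mult.commute flip: power_mult)
      show "2 * card \<Omega> \<le> d" by (fact \<Omega>)
      show "CHAR('a) \<ge> 2 * (2 * (2 * n) - 1)\<^sup>2 * d" using p_ge by (simp add: char)
      show "d \<ge> 2" by (fact d)
      show "\<theta> ^ (CHAR('a) ^ j) \<noteq> \<theta>" if "0 < j" "j < 2 * n" for j using \<theta>(2) that .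
      fix y :: nat
      have "of_nat y + \<theta> \<in> A"
        using plane.add_closed assms(17) \<theta>(1) by (induction y) (simp_all add: add.assoc)
      \<comment> \<open>Otherwise \<theta> would lie in the prime field and be fixed by Frobenius,
        against its choice for \<open>j = 1\<close>.\<close>
      moreover have "of_nat y + \<theta> \<noteq> 0"
      proof
        assume 0: "of_nat y + \<theta> = 0"
        hence "(of_nat y + \<theta>) ^ (CHAR('a) ^ 1) = 0" using p_big char by (simp add: power_0_left)
        hence "of_nat y + \<theta> ^ (CHAR('a) ^ 1) = of_nat y + \<theta>"
          unfolding frobenius_add(1)[OF prime_CHAR_finite_field refl] of_nat_frobenius_fixed using 0 by simp
        thus False using \<theta>(2)[of 1] n by simp
      qed
      ultimately show "(of_nat y + \<theta>) ^ E \<in> \<Omega>" using diff[of "of_nat y + \<theta>" 0] assms(16) by simp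
    qed
  qed
qed

end
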